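(* Let $\Gamma$ be a free group with free generating set $\mathcal A=\{a_1,\dots,a_p\}$, $p\ge 2$, let $\mathfrak C$ be a non-trivial conjugacy class in $\Gamma$, let $k=\min\{|x| : x\in\mathfrak C\}$ and $\mathfrak C_n=\{x\in\mathfrak C : |x|=n\}$. Suppose that $F:\Gamma\to\mathbb R$ satisfies: (A1) there exists a Hölder continuous function $f:\Sigma^*\to\mathbb R$ such that $F(x)=f^n(x)$ for each $x\in\Gamma_n$ and each $n\ge 0$; (A2) $F(x)=F(x^{-1})$ for all $x\in\Gamma$. Then there exists $\overline F\in\mathbb R$ such that $$\lim_{m\to\infty}\frac{1}{\#\mathfrak C_{k+2m}}\sum_{x\in\mathfrak C_{k+2m}}\frac{F(x)}{k+2m}=\overline F .$$ Furthermore, $\overline F=\int f\,d\mu_0$.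
   Context: $|x|$ denotes the word length of $x\in\Gamma$ with respect to $\mathcal A$ (the length of the reduced word representing $x$, with $|1|=0$), and $\Gamma_n=\{x\in\Gamma : |x|=n\}$. The set $\mathfrak C_n$ is non-empty if and only if $n=k+2m$ for some integer $m\ge0$. $\Sigma$ is the space of infinite reduced words, i.e. sequences $(x_n)_{n\ge 0}$ in $\mathcal A\cup\mathcal A^{-1}$ with $x_{n+1}\ne x_n^{-1}$ for all $n\ge0$. $\Sigma^*=\Sigma\cup\Gamma$, where elements of $\Gamma$ are identified with finite reduced words (a finite word is regarded as an infinite sequence ending in an infinite string of the empty symbol $1$). The shift $\sigma:\Sigma^*\to\Sigma^*$ deletes the first letter: $(\sigma x)_n=x_{n+1}$, with $\sigma 1=1$. Fix $0<\theta<1$; the metric on $\Sigma^*$ is $d_\theta(x,x)=0$ and $d_\theta(x,y)=\theta^{\min\{n\ge0 : x_n\neq y_n\}}$ for $x\ne y$; Hölder continuity is with respect to $d_\theta$. The Birkhoff sums are $f^n(x)=f(x)+f(\sigma x)+\cdots+f(\sigma^{n-1}x)$ (with $f^0=0$). $\mu_0$ is the measure of maximal entropy of $\sigma:\Sigma\to\Sigma$: the $\sigma$-invariant Borel probability measure on $\Sigma$ giving, for each reduced word $w=w_0\cdots w_{n-1}$ of length $n\ge 1$, mass $(2p)^{-1}(2p-1)^{-(n-1)}$ to the cylinder $\{(x_j)_{j\ge0} : x_j=w_j,\ 0\le j\le n-1\}$. *)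

theory Defs
  imports "HOL-Algebra.Group" "HOL-Probability.Probability"
begin

definition letters :: "('g, 'm) monoid_scheme \<Rightarrow> 'g set \<Rightarrow> 'g set" where
  "letters G A = A \<union> m_inv G ` A"

definition reduced_words :: "('g, 'm) monoid_scheme \<Rightarrow> 'g set \<Rightarrow> 'g list set" where
  "reduced_words G A =
     {w. set w \<subseteq> letters G A \<and> (\<forall>i. Suc i < length w \<longrightarrow> w ! Suc i \<noteq> inv\<^bsub>G\<^esub> (w ! i))}"

definition word_eval :: "('g, 'm) monoid_scheme \<Rightarrow> 'g list \<Rightarrow> 'g" where
  "word_eval G w = foldr (\<lambda>a x. a \<otimes>\<^bsub>G\<^esub> x) w \<one>\<^bsub>G\<^esub>"

text \<open>
  Every element is represented by exactly one reduced word. Since letters are group elements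
  here and not formal symbols, the disjointness condition is needed: without it a free product of
  groups of order two, with \<open>A\<close> consisting of involutions, would qualify.
\<close>
definition free_generating_set :: "('g, 'm) monoid_scheme \<Rightarrow> 'g set \<Rightarrow> bool" where
  "free_generating_set G A \<longleftrightarrow>
     A \<subseteq> carrier G \<and> A \<inter> m_inv G ` A = {} \<and>
     bij_betw (word_eval G) (reduced_words G A) (carrier G)"

definition reduced_word :: "('g, 'm) monoid_scheme \<Rightarrow> 'g set \<Rightarrow> 'g \<Rightarrow> 'g list" where
  "reduced_word G A x = (THE w. w \<in> reduced_words G A \<and> word_eval G w = x)"

definition word_length :: "('g, 'm) monoid_scheme \<Rightarrow> 'g set \<Rightarrow> 'g \<Rightarrow> nat" where
  "word_length G A x = length (reduced_word G A x)"

definition conjugacy_class :: "('g, 'm) monoid_scheme \<Rightarrow> 'g \<Rightarrow> 'g set" where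
  "conjugacy_class G g = {h \<otimes>\<^bsub>G\<^esub> g \<otimes>\<^bsub>G\<^esub> inv\<^bsub>G\<^esub> h | h. h \<in> carrier G}"

definition level :: "('g, 'm) monoid_scheme \<Rightarrow> 'g set \<Rightarrow> 'g set \<Rightarrow> nat \<Rightarrow> 'g set" where
  "level G A S n = {x \<in> S. word_length G A x = n}"

definition infinite_words :: "('g, 'm) monoid_scheme \<Rightarrow> 'g set \<Rightarrow> (nat \<Rightarrow> 'g) set" where
  "infinite_words G A =
     {x. (\<forall>n. x n \<in> letters G A) \<and> (\<forall>n. x (Suc n) \<noteq> inv\<^bsub>G\<^esub> (x n))}"

text \<open>
  The empty symbol that pads finite words is the unit of the group. It is never a letter, by
  freeness.
\<close>
definition word_seq :: "('g, 'm) monoid_scheme \<Rightarrow> 'g set \<Rightarrow> 'g \<Rightarrow> nat \<Rightarrow> 'g" where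
  "word_seq G A x n =
     (if n < word_length G A x then reduced_word G A x ! n else \<one>\<^bsub>G\<^esub>)"

definition extended_words :: "('g, 'm) monoid_scheme \<Rightarrow> 'g set \<Rightarrow> (nat \<Rightarrow> 'g) set" where
  "extended_words G A = infinite_words G A \<union> word_seq G A ` carrier G"

definition shift_map :: "(nat \<Rightarrow> 'g) \<Rightarrow> nat \<Rightarrow> 'g" where
  "shift_map x = (\<lambda>n. x (Suc n))"

definition seq_dist :: "real \<Rightarrow> (nat \<Rightarrow> 'g) \<Rightarrow> (nat \<Rightarrow> 'g) \<Rightarrow> real" where
  "seq_dist \<theta> x y = (if x = y then 0 else \<theta> ^ (LEAST n. x n \<noteq> y n))"

definition hoelder_on :: "'x set \<Rightarrow> ('x \<Rightarrow> 'x \<Rightarrow> real) \<Rightarrow> ('x \<Rightarrow> real) \<Rightarrow> bool" where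
  "hoelder_on S d f \<longleftrightarrow>
     (\<exists>C \<alpha>. 0 < \<alpha> \<and> \<alpha> \<le> 1 \<and> (\<forall>x\<in>S. \<forall>y\<in>S. \<bar>f x - f y\<bar> \<le> C * d x y powr \<alpha>))"

definition birkhoff_sum :: "((nat \<Rightarrow> 'g) \<Rightarrow> real) \<Rightarrow> nat \<Rightarrow> (nat \<Rightarrow> 'g) \<Rightarrow> real" where
  "birkhoff_sum f n x = (\<Sum>i<n. f ((shift_map ^^ i) x))"

definition cylinder :: "('g, 'm) monoid_scheme \<Rightarrow> 'g set \<Rightarrow> 'g list \<Rightarrow> (nat \<Rightarrow> 'g) set" where
  "cylinder G A w = {x \<in> infinite_words G A. \<forall>j<length w. x j = w ! j}"

definition borel_infinite_words ::
  "('g, 'm) monoid_scheme \<Rightarrow> 'g set \<Rightarrow> real \<Rightarrow> (nat \<Rightarrow> 'g) measure" where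
  "borel_infinite_words G A \<theta> =
     sigma (infinite_words G A)
       {U. openin (Metric_space.mtopology (infinite_words G A) (seq_dist \<theta>)) U}"

definition is_max_entropy_measure ::
  "('g, 'm) monoid_scheme \<Rightarrow> 'g set \<Rightarrow> real \<Rightarrow> (nat \<Rightarrow> 'g) measure \<Rightarrow> bool" where
  "is_max_entropy_measure G A \<theta> M \<longleftrightarrow>
     prob_space M \<and>
     space M = infinite_words G A \<and> sets M = sets (borel_infinite_words G A \<theta>) \<and>
     shift_map \<in> measurable M M \<and> distr M M shift_map = M \<and>
     (\<forall>w \<in> reduced_words G A. w \<noteq> [] \<longrightarrow>
        measure M (cylinder G A w) =
          1 / (2 * real (card A) * (2 * real (card A) - 1) ^ (length w - 1)))"

text \<open>
  The cylinder masses are consistent and determine the measure, so for a finite free generating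
  set with at least two elements the description is satisfied by exactly one measure.
\<close>
definition max_entropy_measure ::
  "('g, 'm) monoid_scheme \<Rightarrow> 'g set \<Rightarrow> real \<Rightarrow> (nat \<Rightarrow> 'g) measure" where
  "max_entropy_measure G A \<theta> = (THE M. is_max_entropy_measure G A \<theta> M)"

end

theory Submission
  imports Defs "HOL-Real_Asymp.Real_Asymp"
begin

text \<open>
  Let $q = 2p - 1$ and write $S(w)$ for the Birkhoff sum of $f$ along a finite reduced word $w$, so
  that $F$ evaluated at the element spelled by $w$ is $S(w)$. An element of length $k + 2m$ in the
  class is spelled by a unique word $v^{-1} c v$, where $c$ is one of the cyclically reduced words of
  length $k$ in the class, $v$ is reduced of length $m$, and the first letter of $v$ avoids two
  letters determined by $c$ (\<open>class_words_eq\<close>). By the Hoelder condition $S$ is additive under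
  concatenation up to a uniformly bounded error (\<open>word_sum_append_close\<close>), and the symmetry of $F$
  says $S(v^{-1}) = S(v)$. Hence $S(v^{-1} c v) = 2 S(v) + O(1)$ with a bound that does not depend on
  $m$, and after division by $k + 2m$ it remains to average $S(v) / m$ over the words $v$ of length
  $m$ with a prescribed first letter $a$.

  Let $e_n(a)$ be the average of $S$ over the words of length $n + 1$ that start with $a$, and
  $\beta_n(a)$ that of $f$. Removing the first letter gives
  $e_{n+1}(a) = \beta_{n+1}(a) + q^{-1} \sum_{b \neq a^{-1}} e_n(b)$. Each letter has exactly $q$
  predecessors, so the mean of $e_n$ over all letters simply increases by the mean of $\beta_{n+1}$;
  the deviation of $e_n(a)$ from that mean is reflected and divided by $q$ at each step, hence stays
  bounded. Therefore $e_n(a) / n$ has the same limit as the mean of $\beta_n$, whichever the letter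
  (\<open>average_of_branching_recurrence\<close>).

  The mean of $\beta_n$ over the letters is the average of $f$ over all words of length $n + 1$. That
  is the integral against the measure of maximal entropy of the function obtained from $f$ by
  truncating infinite words, because all cylinders of the same length have the same mass, and the
  truncations converge to $f$ uniformly (\<open>level_mean_tendsto_integral\<close>). As the measure enters
  through a definite description, its existence and uniqueness are part of the proof
  (\<open>exists_max_entropy_measure\<close>, \<open>prob_measure_eqI_cylinder\<close>).
\<close>

section \<open>Reduced words\<close>

locale free_group = group G for G :: "('g, 'm) monoid_scheme" (structure) +
  fixes A :: "'g set"
  assumes finite_basis: "finite A"
    and card_basis: "card A \<ge> 2"
    and basis: "free_generating_set G A"
begin

abbreviation "L \<equiv> letters G A"
abbreviation "R \<equiv> reduced_words G A"
abbreviation "q \<equiv> 2 * real (card A) - 1"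

definition inv_word :: "'g list \<Rightarrow> 'g list" where
  "inv_word w = rev (map (m_inv G) w)"

lemma letters_subset_carrier: "L \<subseteq> carrier G"
  using basis by (auto simp: letters_def free_generating_set_def)

lemma letter_in_carrier [simp]: "a \<in> L \<Longrightarrow> a \<in> carrier G"
  using letters_subset_carrier by auto

lemma letter_inv_inv [simp]: "a \<in> L \<Longrightarrow> inv (inv a) = a"
  by simp

lemma inv_letter [simp]: "a \<in> L \<Longrightarrow> inv a \<in> L"
  using basis by (auto simp: letters_def free_generating_set_def image_iff subset_iff)

lemma inv_letter_neq: "a \<in> L \<Longrightarrow> inv a \<noteq> a"
  using basis by (auto simp: letters_def free_generating_set_def image_iff subset_iff) (metis IntI empty_iff image_eqI)+

lemma finite_letters [simp]: "finite L"
  using finite_basis by (simp add: letters_def)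

lemma card_letters: "card L = 2 * card A"
proof -
  have "inj_on (m_inv G) A"
    using basis by (intro inj_on_inverseI[of _ "m_inv G"]) (auto simp: free_generating_set_def)
  hence "card (m_inv G ` A) = card A" by (rule card_image)
  thus ?thesis
    using card_Un_disjoint[of A "m_inv G ` A"] finite_basis basis
    by (simp add: letters_def free_generating_set_def)
qed

lemma reduced_iff_successively:
  "w \<in> R \<longleftrightarrow> set w \<subseteq> L \<and> successively (\<lambda>a b. b \<noteq> inv a) w"
  by (auto simp: reduced_words_def successively_conv_nth)

lemma Nil_reduced [simp]: "[] \<in> R"
  by (simp add: reduced_iff_successively)

lemma reduced_append_iff:
  "u @ v \<in> R \<longleftrightarrow> u \<in> R \<and> v \<in> R \<and> (u = [] \<or> v = [] \<or> hd v \<noteq> inv (last u))"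
  by (auto simp: reduced_iff_successively successively_append_iff)

lemma reduced_Cons_iff:
  "a # w \<in> R \<longleftrightarrow> a \<in> L \<and> w \<in> R \<and> (w = [] \<or> hd w \<noteq> inv a)"
  by (auto simp: reduced_iff_successively successively_Cons)

lemma reduced_set: "w \<in> R \<Longrightarrow> set w \<subseteq> L"
  by (simp add: reduced_iff_successively)

lemma length_inv_word [simp]: "length (inv_word w) = length w"
  by (simp add: inv_word_def)

lemma inv_word_Nil_iff [simp]: "inv_word w = [] \<longleftrightarrow> w = []"
  by (simp add: inv_word_def)

lemma last_inv_word: "w \<noteq> [] \<Longrightarrow> last (inv_word w) = inv (hd w)"
  by (simp add: inv_word_def last_rev hd_map)

lemma set_inv_word: "set w \<subseteq> L \<Longrightarrow> set (inv_word w) \<subseteq> L"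
  by (auto simp: inv_word_def)

lemma inv_word_inv_word: "set w \<subseteq> L \<Longrightarrow> inv_word (inv_word w) = w"
  by (induction w) (auto simp: inv_word_def)

lemma inv_word_reduced: "w \<in> R \<Longrightarrow> inv_word w \<in> R"
proof (induction w)
  case (Cons a w)
  have "inv_word (a # w) = inv_word w @ [inv a]" by (simp add: inv_word_def)
  moreover have "w \<noteq> [] \<Longrightarrow> hd w \<in> L" using Cons.prems reduced_set[of "a # w"] by (cases w) auto
  ultimately show ?case
    using Cons by (auto simp: reduced_append_iff reduced_Cons_iff last_inv_word)
qed (simp add: inv_word_def)

lemma word_eval_Nil [simp]: "word_eval G [] = \<one>"
  by (simp add: word_eval_def)

lemma word_eval_Cons [simp]: "word_eval G (a # w) = a \<otimes> word_eval G w"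
  by (simp add: word_eval_def)

lemma word_eval_closed [simp]: "set w \<subseteq> L \<Longrightarrow> word_eval G w \<in> carrier G"
  by (induction w) auto

lemma word_eval_append:
  "set u \<subseteq> L \<Longrightarrow> set v \<subseteq> L \<Longrightarrow> word_eval G (u @ v) = word_eval G u \<otimes> word_eval G v"
  by (induction u) (auto simp: m_assoc)

lemma word_eval_inv_word:
  "set w \<subseteq> L \<Longrightarrow> word_eval G (inv_word w) = inv (word_eval G w)"
proof (induction w)
  case (Cons a w)
  have "inv_word (a # w) = inv_word w @ [inv a]" by (simp add: inv_word_def)
  thus ?case using Cons set_inv_word[of w] by (simp add: word_eval_append inv_mult_group)
qed (simp add: inv_word_def)

lemma word_eval_bij: "bij_betw (word_eval G) R (carrier G)"
  using basis by (simp add: free_generating_set_def)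

lemma word_eval_inj: "u \<in> R \<Longrightarrow> v \<in> R \<Longrightarrow> word_eval G u = word_eval G v \<Longrightarrow> u = v"
  using word_eval_bij by (auto simp: bij_betw_def inj_on_def)

lemma reduced_word_word_eval [simp]: "w \<in> R \<Longrightarrow> reduced_word G A (word_eval G w) = w"
  unfolding reduced_word_def using word_eval_inj by blast

lemma obtain_reduced_word:
  assumes "x \<in> carrier G" obtains w where "w \<in> R" "x = word_eval G w"
  using word_eval_bij assms by (metis bij_betw_iff_bijections)

lemma word_length_word_eval [simp]: "w \<in> R \<Longrightarrow> word_length G A (word_eval G w) = length w"
  by (simp add: word_length_def)

text \<open>
  The one-letter word $1$ would be a second reduced spelling of the unit.
\<close>

lemma one_not_letter: "\<one> \<notin> L"
proof
  assume "\<one> \<in> L"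
  hence "[\<one>] = []" by (intro word_eval_inj) (auto simp: reduced_Cons_iff)
  thus False by simp
qed

section \<open>Words representing a conjugacy class\<close>

text \<open>
  Every rotation of \<open>c\<close> is a subword of \<open>c @ c\<close>, so this condition makes all of them reduced.
\<close>

definition cyclically_reduced :: "'g list \<Rightarrow> bool" where
  "cyclically_reduced c \<longleftrightarrow> c \<noteq> [] \<and> c @ c \<in> R"

lemma cyclically_reduced_iff:
  "cyclically_reduced c \<longleftrightarrow> c \<noteq> [] \<and> c \<in> R \<and> hd c \<noteq> inv (last c)"
  by (auto simp: cyclically_reduced_def reduced_append_iff)

lemma cyclically_reduced_rotate1:
  "cyclically_reduced (a # u) \<longleftrightarrow> cyclically_reduced (u @ [a])"
  by (cases u) (auto simp: cyclically_reduced_iff reduced_append_iff reduced_Cons_iff)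

text \<open>
  The words \<open>inv_word v @ c @ v\<close> with a cyclically reduced middle part of fixed length are closed
  under conjugation by a letter. If the conjugating letter cancels the outermost letter of \<open>v\<close>, then
  \<open>v\<close> gets shorter; if \<open>v\<close> is empty and the letter cancels at one end of \<open>c\<close>, then \<open>c\<close> is rotated;
  otherwise nothing cancels and \<open>v\<close> gets longer.
\<close>

lemma conj_word_by_letter:
  assumes "inv_word v @ c @ v \<in> R" "cyclically_reduced c" "a \<in> L"
  shows "\<exists>v' c'. inv_word v' @ c' @ v' \<in> R \<and> cyclically_reduced c' \<and> length c' = length c \<and>
           word_eval G (inv_word v' @ c' @ v') = a \<otimes> word_eval G (inv_word v @ c @ v) \<otimes> inv a"
proof (cases v rule: rev_cases)
  case (snoc v1 b)
  define z where "z = inv_word v1 @ c @ v1"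
  have y: "inv_word v @ c @ v = inv b # z @ [b]"
    by (simp add: snoc z_def inv_word_def)
  have red: "inv b # z @ [b] \<in> R" using assms(1) by (simp add: y)
  hence z: "z \<in> R" "b \<in> L" "z \<noteq> []"
    using assms(2) by (auto simp: reduced_Cons_iff reduced_append_iff z_def cyclically_reduced_def)
  have ev: "word_eval G (inv b # z @ [b]) = inv b \<otimes> word_eval G z \<otimes> b"
    using z reduced_set[OF z(1)] by (simp add: word_eval_append m_assoc)
  show ?thesis
  proof (cases "b = a")
    case True
    have "a \<otimes> (inv a \<otimes> word_eval G z \<otimes> a) \<otimes> inv a = word_eval G z"
      using z assms(3) reduced_set[OF z(1)] by (simp add: m_assoc inv_solve_left)
        (simp add: m_assoc[symmetric])
    thus ?thesis
      unfolding y ev by - (rule exI[of _ v1], rule exI[of _ c],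
        use z assms(2) in \<open>simp add: True flip: z_def\<close>)
  next
    case False
    have w: "inv_word (v @ [inv a]) @ c @ v @ [inv a] = a # inv b # z @ [b, inv a]"
      using assms(3) by (simp add: snoc z_def inv_word_def)
    have "inv b \<noteq> inv a" "inv a \<noteq> inv b" using False z assms(3) by (metis letter_inv_inv)+
    hence "a # inv b # z @ [b, inv a] \<in> R"
      using red assms(3) z by (auto simp: reduced_Cons_iff reduced_append_iff)
    moreover have "word_eval G (a # inv b # z @ [b, inv a])
        = a \<otimes> word_eval G (inv b # z @ [b]) \<otimes> inv a"
      using z assms(3) reduced_set[OF z(1)] by (simp add: word_eval_append m_assoc)
    ultimately show ?thesis
      unfolding y by - (rule exI[of _ "v @ [inv a]"], rule exI[of _ c], simp only: w assms(2) simp_thms)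
  qed
next
  case Nil
  have y: "inv_word v @ c @ v = c" by (simp add: Nil inv_word_def)
  have c: "c \<in> R" "c \<noteq> []" using assms(2) by (auto simp: cyclically_reduced_iff)
  consider u where "c = inv a # u" | u where "c = u @ [a]" | "hd c \<noteq> inv a" "last c \<noteq> a"
    using c by (metis append_butlast_last_id list.collapse)
  thus ?thesis
  proof cases
    case 1
    have u: "set u \<subseteq> L" using reduced_set[OF c(1)] 1 by auto
    hence "word_eval G (u @ [inv a]) = a \<otimes> word_eval G c \<otimes> inv a"
      using assms(3) by (simp add: 1 word_eval_append) (simp add: m_assoc[symmetric])
    thus ?thesis
      using assms(2) unfolding y 1 cyclically_reduced_rotate1
      by - (rule exI[of _ "[]"], rule exI[of _ "u @ [inv a]"],
        auto simp: Nil inv_word_def cyclically_reduced_iff)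
  next
    case 2
    have u: "set u \<subseteq> L" using reduced_set[OF c(1)] 2 by auto
    hence "word_eval G (a # u) = a \<otimes> word_eval G c \<otimes> inv a"
      using assms(3) by (simp add: 2 word_eval_append m_assoc)
    thus ?thesis
      using assms(2) unfolding y 2 cyclically_reduced_rotate1[symmetric]
      by - (rule exI[of _ "[]"], rule exI[of _ "a # u"],
        auto simp: Nil inv_word_def cyclically_reduced_iff)
  next
    case 3
    have "last c \<in> L" using c reduced_set last_in_set by blast
    hence "inv a \<noteq> inv (last c)" using 3 assms(3) by (metis letter_inv_inv)
    hence "a # c @ [inv a] \<in> R" using c 3 assms(3)
      by (auto simp: reduced_Cons_iff reduced_append_iff)
    moreover have "word_eval G (a # c @ [inv a]) = a \<otimes> word_eval G c \<otimes> inv a"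
      using assms(3) reduced_set[OF c(1)] by (simp add: word_eval_append m_assoc)
    ultimately show ?thesis
      using assms(2,3) unfolding y
      by - (rule exI[of _ "[inv a]"], rule exI[of _ c], simp add: inv_word_def)
  qed
qed

text \<open>
  Consequently all cyclically reduced words in one conjugacy class have the same length, and every
  reduced word of the class is one of them, conjugated without cancellation.
\<close>

lemma conj_word:
  assumes "cyclically_reduced c" "set h \<subseteq> L"
  shows "\<exists>v c'. inv_word v @ c' @ v \<in> R \<and> cyclically_reduced c' \<and> length c' = length c \<and>
           word_eval G (inv_word v @ c' @ v) = word_eval G h \<otimes> word_eval G c \<otimes> inv (word_eval G h)"
  using assms(2)
proof (induction h)
  case Nil
  have c: "c \<in> R" using assms(1) by (simp add: cyclically_reduced_iff)
  show ?case
    by (rule exI[of _ "[]"], rule exI[of _ c]) (use assms(1) c reduced_set[OF c] in \<open>simp add: inv_word_def\<close>)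
next
  case (Cons a h)
  have c: "set c \<subseteq> L" using assms(1) reduced_set by (simp add: cyclically_reduced_iff)
  from Cons obtain v c' where IH: "inv_word v @ c' @ v \<in> R" "cyclically_reduced c'" "length c' = length c"
    "word_eval G (inv_word v @ c' @ v) = word_eval G h \<otimes> word_eval G c \<otimes> inv (word_eval G h)" by auto
  have "word_eval G (a # h) \<otimes> word_eval G c \<otimes> inv (word_eval G (a # h))
      = a \<otimes> (word_eval G h \<otimes> word_eval G c \<otimes> inv (word_eval G h)) \<otimes> inv a"
    using Cons.prems c by (simp add: m_assoc inv_mult_group)
  thus ?case using conj_word_by_letter[OF IH(1,2), of a] Cons.prems IH(3,4) by simp
qed

lemma conjugacy_class_closed:
  assumes "g \<in> carrier G" "x \<in> conjugacy_class G g" "h \<in> carrier G"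
  shows "h \<otimes> x \<otimes> inv h \<in> conjugacy_class G g"
proof -
  obtain h' where h': "h' \<in> carrier G" "x = h' \<otimes> g \<otimes> inv h'"
    using assms(2) by (auto simp: conjugacy_class_def)
  have "h \<otimes> x \<otimes> inv h = (h \<otimes> h') \<otimes> g \<otimes> inv (h \<otimes> h')"
    using assms h' by (simp add: m_assoc inv_mult_group)
  thus ?thesis using assms h' by (auto simp: conjugacy_class_def)
qed

lemma conjugacy_class_sym:
  assumes "g \<in> carrier G" "x \<in> conjugacy_class G g"
  shows "\<exists>h \<in> carrier G. g = h \<otimes> x \<otimes> inv h"
proof -
  obtain h where h: "h \<in> carrier G" "x = h \<otimes> g \<otimes> inv h"
    using assms(2) by (auto simp: conjugacy_class_def)
  have "inv h \<otimes> x \<otimes> inv (inv h) = g"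
    using assms(1) h by (simp add: m_assoc) (simp add: m_assoc[symmetric])
  thus ?thesis using h(1) by (metis inv_closed)
qed

lemma conjugacy_class_in_carrier: "g \<in> carrier G \<Longrightarrow> conjugacy_class G g \<subseteq> carrier G"
  by (auto simp: conjugacy_class_def)

lemma conjugacy_class_subset:
  assumes "g \<in> carrier G" "x \<in> conjugacy_class G g"
  shows "conjugacy_class G x \<subseteq> conjugacy_class G g"
proof
  fix y assume "y \<in> conjugacy_class G x"
  then obtain h where "h \<in> carrier G" "y = h \<otimes> x \<otimes> inv h"
    by (auto simp: conjugacy_class_def)
  thus "y \<in> conjugacy_class G g" using conjugacy_class_closed[OF assms] by simp
qed

lemma conjugacy_class_eq:
  assumes "g \<in> carrier G" "x \<in> conjugacy_class G g"
  shows "conjugacy_class G x = conjugacy_class G g"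
proof -
  have x: "x \<in> carrier G" using assms conjugacy_class_in_carrier by blast
  have "g \<in> conjugacy_class G x"
    using conjugacy_class_sym[OF assms] by (auto simp: conjugacy_class_def)
  thus ?thesis
    using conjugacy_class_subset[OF assms] conjugacy_class_subset[OF x] by blast
qed

text \<open>
  A word of minimal length in the class is cyclically reduced, as otherwise conjugation by its last
  letter would remove both end letters.
\<close>

lemma exists_cyclically_reduced_of_min_length:
  assumes g: "g \<in> carrier G" and nontriv: "conjugacy_class G g \<noteq> {\<one>}"
    and k: "k = (LEAST n. \<exists>x\<in>conjugacy_class G g. word_length G A x = n)"
  shows "\<exists>c. cyclically_reduced c \<and> length c = k \<and> word_eval G c \<in> conjugacy_class G g"
proof -
  have gg: "g \<in> conjugacy_class G g" using g by (auto simp: conjugacy_class_def intro!: exI[of _ "\<one>"])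
  let ?P = "\<lambda>n. \<exists>x\<in>conjugacy_class G g. word_length G A x = n"
  have "?P (word_length G A g)" using gg by blast
  hence "?P k" unfolding k by (rule LeastI[of ?P])
  then obtain x where x: "x \<in> conjugacy_class G g" "word_length G A x = k" by blast
  then obtain c where c: "c \<in> R" "x = word_eval G c"
    using conjugacy_class_in_carrier[OF g] by (blast elim: obtain_reduced_word)
  have len: "length c = k" using c x by simp
  have "cyclically_reduced c"
  proof (rule ccontr)
    assume neg: "\<not> cyclically_reduced c"
    have ne: "c \<noteq> []"
    proof
      assume "c = []"
      hence "conjugacy_class G g = conjugacy_class G \<one>" using conjugacy_class_eq[OF g x(1)] c by simp
      also have "\<dots> = {\<one>}" by (auto simp: conjugacy_class_def intro!: exI[of _ "\<one>"])
      finally show False using nontriv by simp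
    qed
    hence hd: "hd c = inv (last c)" using neg c by (simp add: cyclically_reduced_iff)
    have lastL: "last c \<in> L" using ne c reduced_set last_in_set by blast
    obtain z b where c_eq: "c = inv b # z @ [b]" "b \<in> L"
    proof (cases c rule: rev_cases)
      case (snoc u b)
      moreover have "u \<noteq> []" using snoc hd inv_letter_neq[OF lastL] by auto
      ultimately have "c = inv b # tl u @ [b]" using hd by (cases u) auto
      thus ?thesis using that lastL snoc by simp
    qed (use ne in simp)
    have z: "z \<in> R" using c unfolding c_eq by (simp add: reduced_Cons_iff reduced_append_iff)
    have "word_eval G z = b \<otimes> word_eval G c \<otimes> inv b"
      using c_eq reduced_set[OF z] by (simp add: word_eval_append m_assoc) (simp add: m_assoc[symmetric])
    hence "word_eval G z \<in> conjugacy_class G g"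
      using conjugacy_class_closed[OF g x(1), of b] c c_eq by simp
    hence "?P (length z)" using z by force
    hence "k \<le> length z" unfolding k by (rule Least_le[of ?P])
    thus False using len c_eq by simp
  qed
  thus ?thesis using len c x by blast
qed

definition cyclic_words :: "'g set \<Rightarrow> nat \<Rightarrow> 'g list set" where
  "cyclic_words C k = {c. cyclically_reduced c \<and> length c = k \<and> word_eval G c \<in> C}"

text \<open>
  For length $0$ this set is empty, so the recursion over the first letter starts at length $1$.
\<close>

definition words_from :: "'g \<Rightarrow> nat \<Rightarrow> 'g list set" where
  "words_from a n = {w \<in> R. length w = n \<and> w \<noteq> [] \<and> hd w = a}"

lemma finite_words_of_length: "finite {w \<in> R. length w = n \<and> P w}"
  by (rule finite_subset[OF _ finite_lists_length_eq[of L n]]) (auto dest: reduced_set)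

lemma finite_cyclic_words: "finite (cyclic_words C k)"
  by (rule finite_subset[OF _ finite_lists_length_eq[of L k]])
    (auto simp: cyclic_words_def cyclically_reduced_iff dest: reduced_set)

lemma finite_words_from [simp]: "finite (words_from a n)"
  unfolding words_from_def by (rule finite_words_of_length)

lemma reduced_hd: "w \<in> R \<Longrightarrow> w \<noteq> [] \<Longrightarrow> hd w \<in> L"
  using reduced_set hd_in_set by blast

lemma words_from_one: "a \<in> L \<Longrightarrow> words_from a (Suc 0) = {[a]}"
  by (auto simp: words_from_def length_Suc_conv reduced_Cons_iff)

lemma words_from_Suc:
  assumes "a \<in> L"
  shows "words_from a (Suc (Suc n)) = (#) a ` (\<Union>b\<in>L - {inv a}. words_from b (Suc n))"
proof (intro equalityI subsetI)
  fix w assume "w \<in> words_from a (Suc (Suc n))"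
  then obtain b v where w: "w = a # b # v" "a # b # v \<in> R" "length v = n"
    by (auto simp: words_from_def length_Suc_conv)
  thus "w \<in> (#) a ` (\<Union>b\<in>L - {inv a}. words_from b (Suc n))"
    by (auto simp: words_from_def reduced_Cons_iff intro!: imageI)
next
  fix w assume "w \<in> (#) a ` (\<Union>b\<in>L - {inv a}. words_from b (Suc n))"
  thus "w \<in> words_from a (Suc (Suc n))"
    using assms by (auto simp: words_from_def reduced_Cons_iff)
qed

lemma sum_words_from_Suc:
  assumes "a \<in> L"
  shows "sum g (words_from a (Suc (Suc n))) = (\<Sum>b\<in>L - {inv a}. \<Sum>w\<in>words_from b (Suc n). g (a # w))"
proof -
  have "sum g (words_from a (Suc (Suc n))) = (\<Sum>w\<in>(\<Union>b\<in>L - {inv a}. words_from b (Suc n)). g (a # w))"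
    unfolding words_from_Suc[OF assms] by (subst sum.reindex) auto
  also have "\<dots> = (\<Sum>b\<in>L - {inv a}. \<Sum>w\<in>words_from b (Suc n). g (a # w))"
    by (rule sum.UNION_disjoint) (simp_all, auto simp: words_from_def)
  finally show ?thesis .
qed

lemma card_words_from: "a \<in> L \<Longrightarrow> card (words_from a (Suc n)) = (2 * card A - 1) ^ n"
proof (induction n arbitrary: a)
  case 0
  thus ?case by (simp add: words_from_one)
next
  case (Suc n)
  have "card (words_from a (Suc (Suc n))) = (\<Sum>b\<in>L - {inv a}. (2 * card A - 1) ^ n)"
    using sum_words_from_Suc[OF Suc.prems, of "\<lambda>_. 1::nat" n] Suc.IH by simp
  thus ?case using Suc.prems by (simp add: card_Diff_singleton card_letters)
qed

lemma sum_words_of_length: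
  "sum g {w \<in> R. length w = Suc n} = (\<Sum>a\<in>L. sum g (words_from a (Suc n)))"
proof -
  have "{w \<in> R. length w = Suc n} = (\<Union>a\<in>L. words_from a (Suc n))"
    by (auto simp: words_from_def intro!: reduced_hd)
  moreover have "sum g (\<Union>a\<in>L. words_from a (Suc n)) = (\<Sum>a\<in>L. sum g (words_from a (Suc n)))"
    by (rule sum.UNION_disjoint) (simp_all, auto simp: words_from_def)
  ultimately show ?thesis by simp
qed

text \<open>
  The two forbidden first letters of \<open>v\<close> are different because \<open>c\<close> is cyclically reduced, so that
  $2p - 2$ letters are left.
\<close>

lemma conjugate_reduced_iff:
  assumes "v \<noteq> []" "cyclically_reduced c"
  shows "inv_word v @ c @ v \<in> R \<longleftrightarrow> v \<in> R \<and> hd v \<noteq> hd c \<and> hd v \<noteq> inv (last c)"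
proof -
  have hd: "v \<in> R \<Longrightarrow> hd v \<in> L" using assms(1) reduced_hd by simp
  have "inv_word v \<in> R \<longleftrightarrow> v \<in> R" if "set v \<subseteq> L"
    using inv_word_reduced[of v] inv_word_reduced[of "inv_word v"] inv_word_inv_word[OF that] by auto
  thus ?thesis using assms hd inv_word_reduced[of v]
    by (auto simp: reduced_append_iff cyclically_reduced_iff last_inv_word)
qed

text \<open>
  By \<open>conj_word\<close> the middle part of a word of the class has the minimal length \<open>k\<close>, whichever word it
  is, so that the conjugator takes up exactly \<open>Suc m\<close> letters on either side.
\<close>

lemma class_words_eq:
  assumes g: "g \<in> carrier G" and nontriv: "conjugacy_class G g \<noteq> {\<one>}"
    and k: "k = (LEAST n. \<exists>x\<in>conjugacy_class G g. word_length G A x = n)"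
  shows "{w \<in> R. word_eval G w \<in> conjugacy_class G g \<and> length w = k + 2 * Suc m} =
    (\<lambda>(c, v). inv_word v @ c @ v) `
      (SIGMA c:cyclic_words (conjugacy_class G g) k. \<Union>a\<in>L - {hd c, inv (last c)}. words_from a (Suc m))"
    (is "?W = ?f ` ?P")
proof (intro equalityI subsetI)
  fix w assume w: "w \<in> ?W"
  obtain c where c: "cyclically_reduced c" "length c = k" "word_eval G c \<in> conjugacy_class G g"
    using exists_cyclically_reduced_of_min_length[OF assms] by blast
  hence cc: "word_eval G c \<in> carrier G" using conjugacy_class_in_carrier[OF g] by blast
  have "word_eval G w \<in> conjugacy_class G (word_eval G c)"
    using w conjugacy_class_eq[OF g c(3)] by simp
  then obtain h where h: "h \<in> carrier G" "word_eval G w = h \<otimes> word_eval G c \<otimes> inv h"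
    by (auto simp: conjugacy_class_def)
  then obtain u where u: "u \<in> R" "h = word_eval G u" by (blast elim: obtain_reduced_word)
  obtain v c' where vc: "inv_word v @ c' @ v \<in> R" "cyclically_reduced c'" "length c' = length c"
      "word_eval G (inv_word v @ c' @ v) = word_eval G w"
    using conj_word[OF c(1) reduced_set[OF u(1)]] h u by auto
  have w_eq: "w = inv_word v @ c' @ v" using word_eval_inj vc w by simp
  have len: "length v = Suc m" using w vc(3) c(2) unfolding w_eq by simp
  hence ne: "v \<noteq> []" by auto
  hence v: "v \<in> R" "hd v \<noteq> hd c'" "hd v \<noteq> inv (last c')" "hd v \<in> L"
    using vc(1,2) conjugate_reduced_iff[of v c'] reduced_hd[of v] by simp_all
  have c'R: "set c' \<subseteq> L" using vc(2) reduced_set by (simp add: cyclically_reduced_iff)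
  have vL: "set v \<subseteq> L" using v reduced_set by simp
  have "word_eval G c' = word_eval G v \<otimes> word_eval G w \<otimes> inv (word_eval G v)"
    using c'R vL set_inv_word[OF vL] unfolding w_eq
    by (simp add: word_eval_append word_eval_inv_word m_assoc) (simp add: m_assoc[symmetric])
  hence "word_eval G c' \<in> conjugacy_class G g"
    using conjugacy_class_closed[OF g, of "word_eval G w" "word_eval G v"] w vL by simp
  hence "(c', v) \<in> ?P" using vc c v len ne by (auto simp: cyclic_words_def words_from_def)
  thus "w \<in> ?f ` ?P" by (rule image_eqI[rotated]) (simp add: w_eq)
next
  fix w assume "w \<in> ?f ` ?P"
  then obtain c v where w: "w = inv_word v @ c @ v" "c \<in> cyclic_words (conjugacy_class G g) k"
    "v \<in> words_from (hd v) (Suc m)" "hd v \<noteq> hd c" "hd v \<noteq> inv (last c)"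
    by (auto simp: words_from_def)
  hence c: "cyclically_reduced c" "length c = k" "word_eval G c \<in> conjugacy_class G g"
    and v: "v \<in> R" "length v = Suc m" "v \<noteq> []" by (auto simp: cyclic_words_def words_from_def)
  have cL: "set c \<subseteq> L" using c(1) reduced_set by (simp add: cyclically_reduced_iff)
  have vL: "set v \<subseteq> L" using v reduced_set by simp
  have "word_eval G w = inv (word_eval G v) \<otimes> word_eval G c \<otimes> inv (inv (word_eval G v))"
    using cL vL set_inv_word[OF vL] by (simp add: w(1) word_eval_append word_eval_inv_word m_assoc)
  hence "word_eval G w \<in> conjugacy_class G g"
    using conjugacy_class_closed[OF g c(3), of "inv (word_eval G v)"] vL by simp
  moreover have "w \<in> R" using conjugate_reduced_iff[OF v(3) c(1)] v w by simp
  ultimately show "w \<in> ?W" using c v w(1) by simp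
qed

lemma level_eq_image:
  assumes "C \<subseteq> carrier G"
  shows "level G A C n = word_eval G ` {w \<in> R. word_eval G w \<in> C \<and> length w = n}"
proof (intro equalityI subsetI)
  fix x assume x: "x \<in> level G A C n"
  then obtain w where "w \<in> R" "x = word_eval G w"
    using assms obtain_reduced_word[of x] by (auto simp: level_def)
  thus "x \<in> word_eval G ` {w \<in> R. word_eval G w \<in> C \<and> length w = n}"
    using x by (auto simp: level_def)
qed (auto simp: level_def)

lemma sum_level:
  assumes "C \<subseteq> carrier G"
  shows "sum F (level G A C n) = (\<Sum>w\<in>{w \<in> R. word_eval G w \<in> C \<and> length w = n}. F (word_eval G w))"
  unfolding level_eq_image[OF assms]
  by (subst sum.reindex) (auto simp: inj_on_def dest: word_eval_inj)

lemma sum_class_level: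
  assumes g: "g \<in> carrier G" and nontriv: "conjugacy_class G g \<noteq> {\<one>}"
    and k: "k = (LEAST n. \<exists>x\<in>conjugacy_class G g. word_length G A x = n)"
  shows "sum F (level G A (conjugacy_class G g) (k + 2 * Suc m)) =
    (\<Sum>c\<in>cyclic_words (conjugacy_class G g) k. \<Sum>a\<in>L - {hd c, inv (last c)}.
       \<Sum>v\<in>words_from a (Suc m). F (word_eval G (inv_word v @ c @ v)))"
proof -
  let ?f = "\<lambda>(c, v). inv_word v @ c @ v"
  let ?V = "\<lambda>c. \<Union>a\<in>L - {hd c, inv (last c)}. words_from a (Suc m)"
  let ?P = "SIGMA c:cyclic_words (conjugacy_class G g) k. ?V c"
  \<comment> \<open>The lengths of the three factors are fixed, so the word can be cut in only one way.\<close>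
  have inj: "inj_on ?f ?P"
  proof (rule inj_onI)
    have len: "length (fst p) = k" "length (snd p) = Suc m" if "p \<in> ?P" for p
      using that by (auto simp: words_from_def cyclic_words_def)
    fix p p' assume p: "p \<in> ?P" "p' \<in> ?P" and "?f p = ?f p'"
    hence "inv_word (snd p) @ fst p @ snd p = inv_word (snd p') @ fst p' @ snd p'"
      by (simp only: case_prod_unfold)
    thus "p = p'" using len[OF p(1)] len[OF p(2)] by (simp add: prod_eq_iff)
  qed
  have "sum F (level G A (conjugacy_class G g) (k + 2 * Suc m)) = (\<Sum>w\<in>?f ` ?P. F (word_eval G w))"
    by (simp only: sum_level[OF conjugacy_class_in_carrier[OF g]] class_words_eq[OF assms])
  also have "\<dots> = (\<Sum>(c, v)\<in>?P. F (word_eval G (inv_word v @ c @ v)))"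
    by (subst sum.reindex[OF inj]) (simp add: case_prod_unfold)
  also have "\<dots> = (\<Sum>c\<in>cyclic_words (conjugacy_class G g) k. \<Sum>v\<in>?V c. F (word_eval G (inv_word v @ c @ v)))"
    by (rule sum.Sigma[symmetric]) (auto simp: finite_cyclic_words)
  also have "\<dots> = (\<Sum>c\<in>cyclic_words (conjugacy_class G g) k. \<Sum>a\<in>L - {hd c, inv (last c)}.
       \<Sum>v\<in>words_from a (Suc m). F (word_eval G (inv_word v @ c @ v)))"
    by (intro sum.cong refl sum.UNION_disjoint) (simp_all, auto simp: words_from_def)
  finally show ?thesis .
qed

lemma card_conjugator_letters:
  assumes "cyclically_reduced c"
  shows "card (L - {hd c, inv (last c)}) = 2 * card A - 2"
proof -
  have "hd c \<in> L" "last c \<in> L" "hd c \<noteq> inv (last c)"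
    using assms reduced_set[of c] last_in_set[of c] reduced_hd[of c] by (auto simp: cyclically_reduced_iff)
  thus ?thesis by (subst card_Diff_subset) (auto simp: card_letters)
qed

lemma cyclic_words_nonempty:
  assumes "g \<in> carrier G" "conjugacy_class G g \<noteq> {\<one>}"
    and "k = (LEAST n. \<exists>x\<in>conjugacy_class G g. word_length G A x = n)"
  shows "cyclic_words (conjugacy_class G g) k \<noteq> {}"
  using exists_cyclically_reduced_of_min_length[OF assms] by (auto simp: cyclic_words_def)

lemma card_class_level:
  assumes g: "g \<in> carrier G" and nontriv: "conjugacy_class G g \<noteq> {\<one>}"
    and k: "k = (LEAST n. \<exists>x\<in>conjugacy_class G g. word_length G A x = n)"
  shows "card (level G A (conjugacy_class G g) (k + 2 * Suc m)) =
    card (cyclic_words (conjugacy_class G g) k) * (2 * card A - 2) * (2 * card A - 1) ^ m"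
proof -
  have "card (level G A (conjugacy_class G g) (k + 2 * Suc m)) =
    (\<Sum>c\<in>cyclic_words (conjugacy_class G g) k. \<Sum>a\<in>L - {hd c, inv (last c)}. card (words_from a (Suc m)))"
    using sum_class_level[OF assms, of "\<lambda>_. 1::nat" m] by simp
  also have "\<dots> = (\<Sum>c\<in>cyclic_words (conjugacy_class G g) k. (2 * card A - 2) * (2 * card A - 1) ^ m)"
    by (intro sum.cong refl) (simp add: card_words_from card_conjugator_letters cyclic_words_def)
  finally show ?thesis by simp
qed

end

section \<open>Averages of additive recurrences\<close>

text \<open>
  The Stolz-Cesaro theorem for division by $n$.
\<close>

lemma tendsto_average_of_increments:
  fixes t :: "nat \<Rightarrow> real"
  assumes "(\<lambda>n. t (Suc n) - t n) \<longlonglongrightarrow> l"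
  shows "(\<lambda>n. t n / real n) \<longlonglongrightarrow> l"
proof (rule LIMSEQ_I)
  fix r :: real assume r: "0 < r"
  obtain N where N: "\<And>n. n \<ge> N \<Longrightarrow> \<bar>t (Suc n) - t n - l\<bar> < r / 2"
    using LIMSEQ_D[OF assms, of "r / 2"] r by auto
  have step: "\<bar>t n - t N - real (n - N) * l\<bar> \<le> real (n - N) * (r / 2)" if "n \<ge> N" for n
    using that
  proof (induction n rule: dec_induct)
    case (step n)
    have d: "real (Suc n - N) = real (n - N) + 1" using step by simp
    have "t (Suc n) - t N - real (Suc n - N) * l
        = (t n - t N - real (n - N) * l) + (t (Suc n) - t n - l)"
      unfolding d by (simp only: distrib_right mult_1)
    moreover have "real (Suc n - N) * (r / 2) = real (n - N) * (r / 2) + r / 2"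
      unfolding d by (simp only: distrib_right mult_1)
    ultimately show ?case using step.IH N[OF step(1)] by linarith
  qed simp
  define Z where "Z = \<bar>t N - real N * l\<bar>"
  obtain M where M: "real M > 2 * Z / r" using reals_Archimedean2 by blast
  show "\<exists>n0. \<forall>n\<ge>n0. norm (t n / real n - l) < r"
  proof (intro exI allI impI)
    fix n assume n: "n \<ge> Suc (max M N)"
    have pos: "real n > 0" using n by simp
    have "Z < r / 2 * real n"
    proof -
      have "2 * Z / r < real n" using M n by simp
      thus ?thesis using r by (simp add: field_simps)
    qed
    moreover have "\<bar>t n - real n * l\<bar> \<le> Z + real (n - N) * (r / 2)"
    proof -
      have "t n - real n * l = (t n - t N - real (n - N) * l) + (t N - real N * l)"
        using n by (simp add: of_nat_diff algebra_simps)
      thus ?thesis using step[of n] n unfolding Z_def by linarith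
    qed
    moreover have "real (n - N) * (r / 2) \<le> real n * (r / 2)"
      using r by (intro mult_right_mono) auto
    ultimately have "\<bar>t n - real n * l\<bar> < r * real n" by (simp add: algebra_simps)
    moreover have "t n / real n - l = (t n - real n * l) / real n" using pos by (simp add: field_simps)
    ultimately show "norm (t n / real n - l) < r" using pos by (simp add: pos_divide_less_eq)
  qed
qed

text \<open>
  Averaging the recurrence over the whole alphabet removes the coupling, since every letter is
  omitted exactly once on the right-hand side: the mean of \<open>e\<close> grows by the mean of \<open>\<beta>\<close>. The deviation
  \<open>D\<close> from the mean satisfies the same recurrence with the sum replaced by $- D(\iota a) / q$, a
  contraction, so it remains bounded and disappears after division by \<open>n\<close>.
\<close>

lemma average_of_branching_recurrence:
  fixes e \<beta> :: "nat \<Rightarrow> 'a \<Rightarrow> real" and q B l :: real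
  assumes fin: "finite L" and card: "real (card L) = q + 1" and q: "q \<ge> 2"
    and \<iota>: "\<And>a. a \<in> L \<Longrightarrow> \<iota> a \<in> L" "\<And>a. a \<in> L \<Longrightarrow> \<iota> (\<iota> a) = a"
    and rec: "\<And>n a. a \<in> L \<Longrightarrow> e (Suc n) a = \<beta> (Suc n) a + (\<Sum>b\<in>L - {\<iota> a}. e n b) / q"
    and bound: "\<And>n a. a \<in> L \<Longrightarrow> \<bar>\<beta> n a\<bar> \<le> B"
    and mean: "(\<lambda>n. (\<Sum>a\<in>L. \<beta> n a) / (q + 1)) \<longlonglongrightarrow> l"
    and a: "a \<in> L"
  shows "(\<lambda>n. e n a / real n) \<longlonglongrightarrow> l"
proof -
  define t where "t n = (\<Sum>a\<in>L. e n a) / (q + 1)" for n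
  define b where "b n = (\<Sum>a\<in>L. \<beta> n a) / (q + 1)" for n
  define D where "D n a = e n a - t n" for n a
  have total: "(\<Sum>a\<in>L. e n a) = (q + 1) * t n" for n using q by (simp add: t_def)
  have others: "(\<Sum>b\<in>L - {\<iota> a}. e n b) = (q + 1) * t n - e n (\<iota> a)" if "a \<in> L" for n a
    using that fin \<iota>(1) by (simp add: sum_diff1 total)
  have bij: "bij_betw \<iota> L L"
    by (rule bij_betw_byWitness[of _ \<iota>]) (use \<iota> in auto)
  have t_rec: "t (Suc n) = b (Suc n) + t n" for n
  proof -
    have "(\<Sum>a\<in>L. e n (\<iota> a)) = (q + 1) * t n"
      using sum.reindex_bij_betw[OF bij, of "e n"] total by simp
    hence "(\<Sum>a\<in>L. ((q + 1) * t n - e n (\<iota> a)) / q) = ((q + 1) * ((q + 1) * t n) - (q + 1) * t n) / q"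
      by (simp add: sum_divide_distrib[symmetric] sum_subtractf card)
    also have "\<dots> = (q + 1) * t n" using q by (simp add: field_simps)
    finally have "(\<Sum>a\<in>L. e (Suc n) a) = (\<Sum>a\<in>L. \<beta> (Suc n) a) + (q + 1) * t n"
      by (simp add: rec others sum.distrib)
    thus ?thesis using q by (simp add: t_def b_def add_divide_distrib)
  qed
  hence "(\<lambda>n. t (Suc n) - t n) = (\<lambda>n. b (Suc n))" by auto
  moreover have "(\<lambda>n. b (Suc n)) \<longlonglongrightarrow> l" unfolding b_def by (rule LIMSEQ_Suc[OF mean])
  ultimately have t_lim: "(\<lambda>n. t n / real n) \<longlonglongrightarrow> l" by (intro tendsto_average_of_increments) simp
  have B: "B \<ge> 0" using bound[OF a, of 0] by linarith
  have b_bound: "\<bar>b n\<bar> \<le> B" for n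
  proof -
    have "\<bar>\<Sum>a\<in>L. \<beta> n a\<bar> \<le> (q + 1) * B"
      using sum_norm_bound[of L "\<beta> n" B] bound card by simp
    thus ?thesis using q by (simp add: b_def abs_divide pos_divide_le_eq mult.commute)
  qed
  have D_rec: "D (Suc n) a = \<beta> (Suc n) a - b (Suc n) - D n (\<iota> a) / q" if "a \<in> L" for n a
    using q by (simp add: D_def rec[OF that] others[OF that] t_rec[of n] field_simps)
  \<comment> \<open>One step at least halves the deviation and adds at most \<open>2 * B\<close>, so a bound of at least \<open>4 * B\<close> persists.\<close>
  define M where "M = 4 * B + (\<Sum>a\<in>L. \<bar>D 0 a\<bar>)"
  have D_bound: "\<bar>D n a\<bar> \<le> M" if "a \<in> L" for n a
    using that
  proof (induction n arbitrary: a)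
    case 0
    have "\<bar>D 0 a\<bar> \<le> (\<Sum>a\<in>L. \<bar>D 0 a\<bar>)" using fin 0 by (intro member_le_sum) auto
    thus ?case using B by (simp add: M_def)
  next
    case (Suc n)
    have M: "M \<ge> 4 * B" by (simp add: M_def sum_nonneg)
    have "\<bar>D n (\<iota> a) / q\<bar> \<le> M / 2"
    proof -
      have "\<bar>D n (\<iota> a)\<bar> / q \<le> M / 2"
        using Suc.IH[OF \<iota>(1)[OF Suc.prems]] q by (intro frac_le) auto
      thus ?thesis using q by (simp add: abs_divide)
    qed
    thus ?case using D_rec[OF Suc.prems, of n] bound[OF Suc.prems, of "Suc n"] b_bound[of "Suc n"] M by linarith
  qed
  have "(\<lambda>n. D n a / real n) \<longlonglongrightarrow> 0"
  proof (rule tendsto_rabs_zero_cancel, rule tendsto_sandwich[of "\<lambda>_. 0" _ _ "\<lambda>n. M / real n"])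
    show "(\<lambda>n. M / real n) \<longlonglongrightarrow> 0" by (rule lim_const_over_n)
  qed (use D_bound[OF a] in \<open>auto simp: abs_divide divide_right_mono\<close>)
  from tendsto_add[OF this t_lim] show ?thesis
    by (simp add: D_def diff_divide_distrib)
qed

section \<open>Hoelder potentials\<close>

lemma seq_dist_nonneg: "0 < \<theta> \<Longrightarrow> 0 \<le> seq_dist \<theta> x y"
  by (simp add: seq_dist_def)

lemma seq_dist_le:
  assumes "0 < \<theta>" "\<theta> < 1" and agree: "\<And>j. j < n \<Longrightarrow> x j = y j"
  shows "seq_dist \<theta> x y \<le> \<theta> ^ n"
proof (cases "x = y")
  case False
  then obtain i where "x i \<noteq> y i" by blast
  hence "x (LEAST i. x i \<noteq> y i) \<noteq> y (LEAST i. x i \<noteq> y i)" by (rule LeastI)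
  hence "n \<le> (LEAST i. x i \<noteq> y i)" using agree by (meson not_le)
  thus ?thesis using False assms by (simp add: seq_dist_def power_decreasing)
qed (use assms in \<open>simp add: seq_dist_def\<close>)

lemma agree_if_seq_dist_less:
  assumes "0 < \<theta>" "\<theta> < 1" "seq_dist \<theta> x y < \<theta> ^ n" "j \<le> n"
  shows "x j = y j"
proof (rule ccontr)
  assume "x j \<noteq> y j"
  hence "(LEAST i. x i \<noteq> y i) \<le> n" using Least_le[of "\<lambda>i. x i \<noteq> y i" j] assms(4) by linarith
  hence "\<theta> ^ n \<le> \<theta> ^ (LEAST i. x i \<noteq> y i)" using assms(1,2) by (intro power_decreasing) auto
  thus False using \<open>x j \<noteq> y j\<close> assms(3) by (auto simp: seq_dist_def split: if_splits)
qed

text \<open>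
  In terms of letters, Hoelder continuity says that sequences with a common prefix of length \<open>n\<close> have
  values that differ by at most $K \rho^n$, where $\rho = \theta^\alpha$ for the exponent $\alpha$.
  This is the only form in which the metric enters the estimates.
\<close>

lemma hoelder_on_seq_dist_imp:
  assumes "hoelder_on S (seq_dist \<theta>) f" "0 < \<theta>" "\<theta> < 1"
  obtains K \<rho> where "0 \<le> K" "0 < \<rho>" "\<rho> < 1"
    "\<And>x y n. x \<in> S \<Longrightarrow> y \<in> S \<Longrightarrow> (\<And>j. j < n \<Longrightarrow> x j = y j) \<Longrightarrow> \<bar>f x - f y\<bar> \<le> K * \<rho> ^ n"
proof -
  obtain C \<alpha> where C: "0 < \<alpha>" "\<And>x y. x \<in> S \<Longrightarrow> y \<in> S \<Longrightarrow> \<bar>f x - f y\<bar> \<le> C * seq_dist \<theta> x y powr \<alpha>"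
    using assms(1) unfolding hoelder_on_def by blast
  show ?thesis
  proof (rule that[of "\<bar>C\<bar>" "\<theta> powr \<alpha>"])
    show "\<theta> powr \<alpha> < 1" using powr_less_mono2[of \<alpha> \<theta> 1] assms C(1) by simp
    fix x y n assume xy: "x \<in> S" "y \<in> S" and agree: "\<And>j. j < n \<Longrightarrow> x j = y j"
    have "\<bar>f x - f y\<bar> \<le> C * seq_dist \<theta> x y powr \<alpha>" using C xy by blast
    also have "\<dots> \<le> \<bar>C\<bar> * seq_dist \<theta> x y powr \<alpha>" by (intro mult_right_mono) auto
    also have "\<dots> \<le> \<bar>C\<bar> * (\<theta> ^ n) powr \<alpha>"
      using seq_dist_le[of \<theta> n x y] seq_dist_nonneg[of \<theta> x y] assms(2,3) agree C(1) by (intro mult_left_mono powr_mono2) auto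
    also have "(\<theta> ^ n) powr \<alpha> = (\<theta> powr \<alpha>) ^ n"
      using assms(2) by (simp add: powr_realpow[symmetric] powr_powr mult.commute)
    finally show "\<bar>f x - f y\<bar> \<le> \<bar>C\<bar> * (\<theta> powr \<alpha>) ^ n" .
  qed (use assms in auto)
qed

context free_group
begin

definition pad :: "'g list \<Rightarrow> nat \<Rightarrow> 'g" where
  "pad w n = (if n < length w then w ! n else \<one>)"

lemma word_seq_word_eval: "w \<in> R \<Longrightarrow> word_seq G A (word_eval G w) = pad w"
  by (auto simp: word_seq_def pad_def fun_eq_iff)

lemma pad_extended: "w \<in> R \<Longrightarrow> pad w \<in> extended_words G A"
  using word_seq_word_eval[of w] reduced_set[of w]
  by (auto simp: extended_words_def intro!: image_eqI[of _ _ "word_eval G w"])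

lemma shift_pad_Cons: "shift_map (pad (a # w)) = pad w"
  by (auto simp: shift_map_def pad_def)

end

locale hoelder_potential = free_group G A for G :: "('g, 'm) monoid_scheme" (structure) and A +
  fixes f :: "(nat \<Rightarrow> 'g) \<Rightarrow> real" and K \<rho> :: real
  assumes K: "0 \<le> K" and \<rho>: "0 < \<rho>" "\<rho> < 1"
    and hoelder: "\<lbrakk>x \<in> extended_words G A; y \<in> extended_words G A; \<And>j. j < n \<Longrightarrow> x j = y j\<rbrakk>
      \<Longrightarrow> \<bar>f x - f y\<bar> \<le> K * \<rho> ^ n"
begin

definition potential_bound :: real where "potential_bound = \<bar>f (pad [])\<bar> + K"

lemma potential_bounded: "x \<in> extended_words G A \<Longrightarrow> \<bar>f x\<bar> \<le> potential_bound"
  using hoelder[of x "pad []" 0] pad_extended[of "[]"] by (simp add: potential_bound_def)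

definition word_sum :: "'g list \<Rightarrow> real" where
  "word_sum w = birkhoff_sum f (length w) (pad w)"

lemma word_sum_Nil [simp]: "word_sum [] = 0"
  by (simp add: word_sum_def birkhoff_sum_def)

lemma word_sum_Cons: "word_sum (a # w) = f (pad (a # w)) + word_sum w"
proof -
  have "(shift_map ^^ Suc i) (pad (a # w)) = (shift_map ^^ i) (pad w)" for i
    by (simp add: funpow_Suc_right shift_pad_Cons del: funpow.simps)
  thus ?thesis
    unfolding word_sum_def birkhoff_sum_def length_Cons sum.lessThan_Suc_shift by simp
qed

text \<open>
  The orbits of \<open>u @ v\<close> and of \<open>u\<close> agree, at the moment when $i + 1$ letters of \<open>u\<close> are left, in these
  $i + 1$ letters; the errors add up to a geometric series.
\<close>

lemma word_sum_append_close:
  assumes "u @ v \<in> R"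
  shows "\<bar>word_sum (u @ v) - word_sum u - word_sum v\<bar> \<le> K / (1 - \<rho>)"
proof -
  have "\<bar>word_sum (u @ v) - word_sum u - word_sum v\<bar> \<le> K * (\<Sum>i<length u. \<rho> ^ Suc i)"
    using assms
  proof (induction u)
    case (Cons a u)
    have "a # u \<in> R" "u @ v \<in> R" using Cons.prems
      by (auto simp: reduced_Cons_iff reduced_append_iff split: if_splits)
    have "\<bar>f (pad (a # u @ v)) - f (pad (a # u))\<bar> \<le> K * \<rho> ^ Suc (length u)"
      by (rule hoelder) (use Cons.prems \<open>a # u \<in> R\<close> in
        \<open>auto intro!: pad_extended simp: pad_def nth_append nth_Cons split: nat.split\<close>)
    thus ?case using Cons.IH[OF \<open>u @ v \<in> R\<close>]
      by (simp add: word_sum_Cons algebra_simps)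
  qed simp
  also have "(\<Sum>i<length u. \<rho> ^ Suc i) \<le> 1 / (1 - \<rho>)"
  proof -
    have "(\<Sum>i<length u. \<rho> ^ Suc i) \<le> (\<Sum>i<length u. \<rho> ^ i)"
      using \<rho> by (intro sum_mono power_decreasing) auto
    also have "\<dots> = (1 - \<rho> ^ length u) / (1 - \<rho>)"
      using one_diff_power_eq[of \<rho> "length u"] \<rho> by (simp add: field_simps)
    also have "\<dots> \<le> 1 / (1 - \<rho>)" using \<rho> by (intro divide_right_mono) auto
    finally show ?thesis .
  qed
  finally show ?thesis using K by (simp add: mult_left_mono)
qed

lemma word_sum_bounded: "w \<in> R \<Longrightarrow> \<bar>word_sum w\<bar> \<le> real (length w) * potential_bound"
proof (induction w)
  case (Cons a w)
  have "\<bar>f (pad (a # w))\<bar> \<le> potential_bound" using Cons.prems by (intro potential_bounded pad_extended)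
  moreover have "w \<in> R" using Cons.prems by (simp add: reduced_Cons_iff)
  ultimately show ?case using Cons.IH by (simp add: word_sum_Cons algebra_simps)
qed simp

text \<open>
  Almost additivity is applied at both ends of \<open>c\<close>, whose own contribution is bounded in terms of its
  length.
\<close>

lemma word_sum_conjugate_close:
  assumes sym: "word_sum (inv_word v) = word_sum v"
    and red: "inv_word v @ c @ v \<in> R"
  shows "\<bar>word_sum (inv_word v @ c @ v) - 2 * word_sum v\<bar> \<le> 2 * (K / (1 - \<rho>)) + real (length c) * potential_bound"
proof -
  have "c @ v \<in> R" "c \<in> R" using red by (auto simp: reduced_append_iff)
  thus ?thesis
    using word_sum_append_close[OF red] word_sum_append_close[of c v] word_sum_bounded[of c] sym by linarith
qed

definition level_mean :: "nat \<Rightarrow> real" where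
  "level_mean n = (\<Sum>w\<in>{w \<in> R. length w = Suc n}. f (pad w)) / ((q + 1) * q ^ n)"

definition letter_mean :: "('g list \<Rightarrow> real) \<Rightarrow> nat \<Rightarrow> 'g \<Rightarrow> real" where
  "letter_mean h n a = (\<Sum>w\<in>words_from a (Suc n). h w) / q ^ n"

lemma q_ge: "q \<ge> 3" using card_basis by simp

lemma real_card_words_from: "a \<in> L \<Longrightarrow> real (card (words_from a (Suc n))) = q ^ n"
proof -
  have "real (2 * card A - 1) = q" using card_basis by simp
  thus "a \<in> L \<Longrightarrow> ?thesis" by (simp add: card_words_from)
qed

text \<open>
  The factor \<open>s\<close> serves two applications: $s = 2$ compares conjugates with the conjugating words, and
  $s = 0$ bounds a mean of bounded terms.
\<close>

lemma letter_mean_diff_bound: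
  assumes "a \<in> L" "\<And>w. w \<in> words_from a (Suc n) \<Longrightarrow> \<bar>h w - s * h' w\<bar> \<le> D"
  shows "\<bar>letter_mean h n a - s * letter_mean h' n a\<bar> \<le> D"
proof -
  have q: "q ^ n > 0" using q_ge by simp
  have "\<bar>\<Sum>w\<in>words_from a (Suc n). h w - s * h' w\<bar> \<le> q ^ n * D"
    using sum_norm_bound[of "words_from a (Suc n)" "\<lambda>w. h w - s * h' w" D] assms
    by (simp add: real_card_words_from)
  moreover have "letter_mean h n a - s * letter_mean h' n a = (\<Sum>w\<in>words_from a (Suc n). h w - s * h' w) / q ^ n"
    by (simp add: letter_mean_def sum_subtractf sum_distrib_left diff_divide_distrib)
  ultimately show ?thesis using q by (simp add: abs_divide pos_divide_le_eq mult.commute)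
qed

lemma letter_mean_word_sum_Suc:
  assumes "a \<in> L"
  shows "letter_mean word_sum (Suc n) a
    = letter_mean (\<lambda>w. f (pad w)) (Suc n) a + (\<Sum>b\<in>L - {inv a}. letter_mean word_sum n b) / q"
  unfolding letter_mean_def sum_words_from_Suc[OF assms]
  by (simp add: word_sum_Cons sum.distrib add_divide_distrib sum_divide_distrib[symmetric] mult.commute)

lemma letter_mean_word_sum_limit:
  assumes "level_mean \<longlonglongrightarrow> l" "a \<in> L"
  shows "(\<lambda>n. letter_mean word_sum n a / real n) \<longlonglongrightarrow> l"
proof (rule average_of_branching_recurrence[where L = L and q = q and B = potential_bound and \<iota> = "m_inv G"
      and \<beta> = "letter_mean (\<lambda>w. f (pad w))"])
  show "\<bar>letter_mean (\<lambda>w. f (pad w)) n b\<bar> \<le> potential_bound" if "b \<in> L" for n b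
    using letter_mean_diff_bound[of b n "\<lambda>w. f (pad w)" 0 "\<lambda>_. 0" potential_bound] that
    by (simp add: words_from_def potential_bounded pad_extended)
  have "(\<Sum>a\<in>L. letter_mean (\<lambda>w. f (pad w)) n a) / (q + 1) = level_mean n" for n
    by (simp add: level_mean_def letter_mean_def sum_words_of_length sum_divide_distrib[symmetric] mult.commute)
  thus "(\<lambda>n. (\<Sum>a\<in>L. letter_mean (\<lambda>w. f (pad w)) n a) / (q + 1)) \<longlonglongrightarrow> l" using assms(1) by simp
  show "real (card L) = q + 1" by (simp add: card_letters)
qed (use q_ge assms letter_mean_word_sum_Suc in auto)

text \<open>
  The length of a conjugate is about twice that of \<open>v\<close>, and its sum is about twice that of \<open>v\<close>; the
  two factors cancel.
\<close>

lemma letter_mean_conjugate_limit: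
  assumes lim: "level_mean \<longlonglongrightarrow> l"
    and sym: "\<And>v. v \<in> R \<Longrightarrow> word_sum (inv_word v) = word_sum v"
    and c: "cyclically_reduced c" and a: "a \<in> L" "a \<noteq> hd c" "a \<noteq> inv (last c)"
  shows "(\<lambda>m. letter_mean (\<lambda>v. word_sum (inv_word v @ c @ v)) m a / real (k + 2 * Suc m)) \<longlonglongrightarrow> l"
proof -
  define e where "e = (\<lambda>m. letter_mean word_sum m a)"
  define E where "E = (\<lambda>m. letter_mean (\<lambda>v. word_sum (inv_word v @ c @ v)) m a)"
  define D where "D = 2 * (K / (1 - \<rho>)) + real (length c) * potential_bound"
  have "inv_word v @ c @ v \<in> R" "v \<in> R" if "v \<in> words_from a (Suc m)" for v m
    using that a conjugate_reduced_iff[OF _ c, of v] by (auto simp: words_from_def)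
  hence ED: "\<bar>E m - 2 * e m\<bar> \<le> D" for m
    unfolding E_def e_def D_def
    by (intro letter_mean_diff_bound[OF a(1)] word_sum_conjugate_close sym) auto
  have "(\<lambda>m. (E m - 2 * e m) / real (k + 2 * Suc m)) \<longlonglongrightarrow> 0"
  proof (rule tendsto_rabs_zero_cancel, rule tendsto_sandwich[of "\<lambda>_. 0" _ _ "\<lambda>m. D / real (k + 2 * Suc m)"])
    show "(\<lambda>m. D / real (k + 2 * Suc m)) \<longlonglongrightarrow> 0" by real_asymp
    show "\<forall>\<^sub>F m in sequentially. \<bar>(E m - 2 * e m) / real (k + 2 * Suc m)\<bar> \<le> D / real (k + 2 * Suc m)"
      using ED by (intro always_eventually allI) (simp only: abs_divide abs_of_nat divide_right_mono of_nat_0_le_iff)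
  qed auto
  moreover have "(\<lambda>m. e m / real m * (2 * real m / real (k + 2 * Suc m))) \<longlonglongrightarrow> l * 1"
  proof (intro tendsto_mult)
    show "(\<lambda>m. e m / real m) \<longlonglongrightarrow> l" unfolding e_def by (rule letter_mean_word_sum_limit[OF lim a(1)])
    show "(\<lambda>m. 2 * real m / real (k + 2 * Suc m)) \<longlonglongrightarrow> 1" by real_asymp
  qed
  ultimately have "(\<lambda>m. (E m - 2 * e m) / real (k + 2 * Suc m)
      + e m / real m * (2 * real m / real (k + 2 * Suc m))) \<longlonglongrightarrow> 0 + l * 1"
    by (rule tendsto_add)
  hence "(\<lambda>m. E m / real (k + 2 * Suc m)) \<longlonglongrightarrow> 0 + l * 1"
  proof (rule Lim_transform_eventually)
    show "\<forall>\<^sub>F m in sequentially. (E m - 2 * e m) / real (k + 2 * Suc m)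
      + e m / real m * (2 * real m / real (k + 2 * Suc m)) = E m / real (k + 2 * Suc m)"
      using eventually_gt_at_top[of 0]
    proof eventually_elim
      case (elim m)
      have "(x - 2 * y) / z + y / real m * (2 * real m / z) = x / z" for x y z
        using elim by (simp add: diff_divide_distrib)
      thus ?case .
    qed
  qed
  thus ?thesis by (simp add: E_def)
qed

lemma class_average_limit:
  assumes g: "g \<in> carrier G" and nontriv: "conjugacy_class G g \<noteq> {\<one>}"
    and k: "k = (LEAST n. \<exists>x\<in>conjugacy_class G g. word_length G A x = n)"
    and F: "\<And>w. w \<in> R \<Longrightarrow> F (word_eval G w) = word_sum w"
    and sym: "\<And>x. x \<in> carrier G \<Longrightarrow> F x = F (inv x)"
    and lim: "level_mean \<longlonglongrightarrow> l"
  shows "(\<lambda>m. 1 / real (card (level G A (conjugacy_class G g) (k + 2 * m))) *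
    (\<Sum>x\<in>level G A (conjugacy_class G g) (k + 2 * m). F x / real (k + 2 * m))) \<longlonglongrightarrow> l"
proof -
  define Cs where "Cs = cyclic_words (conjugacy_class G g) k"
  define N where "N = real (card Cs) * (q - 1)"
  let ?E = "\<lambda>c m a. letter_mean (\<lambda>v. word_sum (inv_word v @ c @ v)) m a / real (k + 2 * Suc m)"
  have cyc: "cyclically_reduced c" if "c \<in> Cs" for c using that by (simp add: Cs_def cyclic_words_def)
  have "card Cs > 0" using cyclic_words_nonempty[OF g nontriv k] finite_cyclic_words by (simp add: Cs_def card_gt_0_iff)
  hence N: "N > 0" using q_ge by (simp add: N_def)
  have two: "real (2 * card A - 2) = q - 1" "real (2 * card A - 1) = q" using card_basis by auto
  have sym': "word_sum (inv_word v) = word_sum v" if "v \<in> R" for v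
    using F[OF that] F[OF inv_word_reduced[OF that]] sym[of "word_eval G v"] reduced_set[OF that]
    by (simp add: word_eval_inv_word)
  have "1 / real (card (level G A (conjugacy_class G g) (k + 2 * Suc m))) *
      (\<Sum>x\<in>level G A (conjugacy_class G g) (k + 2 * Suc m). F x / real (k + 2 * Suc m))
      = (\<Sum>c\<in>Cs. \<Sum>a\<in>L - {hd c, inv (last c)}. ?E c m a) / N" for m
  proof -
    have red: "inv_word v @ c @ v \<in> R"
      if "c \<in> Cs" "a \<in> L - {hd c, inv (last c)}" "v \<in> words_from a (Suc m)" for c a v
      using that conjugate_reduced_iff[OF _ cyc[OF that(1)], of v] by (auto simp: words_from_def)
    have "(\<Sum>x\<in>level G A (conjugacy_class G g) (k + 2 * Suc m). F x / real (k + 2 * Suc m))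
      = (\<Sum>c\<in>Cs. \<Sum>a\<in>L - {hd c, inv (last c)}. \<Sum>v\<in>words_from a (Suc m).
          word_sum (inv_word v @ c @ v) / real (k + 2 * Suc m))"
      unfolding sum_class_level[OF g nontriv k] Cs_def[symmetric]
      by (intro sum.cong refl) (simp only: F red)
    also have "\<dots> = (\<Sum>c\<in>Cs. \<Sum>a\<in>L - {hd c, inv (last c)}. q ^ m * ?E c m a)"
    proof (intro sum.cong refl)
      fix c a
      have "q ^ m * (x / q ^ m / z) = x / z" for x z :: real using q_ge by simp
      thus "(\<Sum>v\<in>words_from a (Suc m). word_sum (inv_word v @ c @ v) / real (k + 2 * Suc m))
          = q ^ m * ?E c m a"
        by (simp only: letter_mean_def sum_divide_distrib[symmetric])
    qed
    also have "\<dots> = q ^ m * (\<Sum>c\<in>Cs. \<Sum>a\<in>L - {hd c, inv (last c)}. ?E c m a)"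
      by (simp only: sum_distrib_left)
    finally have "(\<Sum>x\<in>level G A (conjugacy_class G g) (k + 2 * Suc m). F x / real (k + 2 * Suc m))
      = q ^ m * (\<Sum>c\<in>Cs. \<Sum>a\<in>L - {hd c, inv (last c)}. ?E c m a)" .
    moreover have "real (card (level G A (conjugacy_class G g) (k + 2 * Suc m))) = N * q ^ m"
      unfolding card_class_level[OF g nontriv k] Cs_def[symmetric] of_nat_mult of_nat_power two N_def ..
    ultimately show ?thesis using N q_ge by simp
  qed
  moreover have "(\<lambda>m. (\<Sum>c\<in>Cs. \<Sum>a\<in>L - {hd c, inv (last c)}. ?E c m a) / N)
      \<longlonglongrightarrow> (\<Sum>c\<in>Cs. \<Sum>a\<in>L - {hd c, inv (last c)}. l) / N"
    using N by (intro tendsto_divide tendsto_sum tendsto_const letter_mean_conjugate_limit[OF lim sym'] cyc) auto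
  moreover have "(\<Sum>c\<in>Cs. \<Sum>a\<in>L - {hd c, inv (last c)}. l) = N * l"
  proof -
    have "(\<Sum>c\<in>Cs. \<Sum>a\<in>L - {hd c, inv (last c)}. l) = (\<Sum>c\<in>Cs. (q - 1) * l)"
      by (intro sum.cong refl) (simp only: sum_constant card_conjugator_letters[OF cyc] two)
    thus ?thesis by (simp add: N_def)
  qed
  ultimately have "(\<lambda>m. 1 / real (card (level G A (conjugacy_class G g) (k + 2 * Suc m))) *
    (\<Sum>x\<in>level G A (conjugacy_class G g) (k + 2 * Suc m). F x / real (k + 2 * Suc m))) \<longlonglongrightarrow> l"
    using N by simp
  thus ?thesis by (rule LIMSEQ_imp_Suc)
qed

end

section \<open>The measure of maximal entropy\<close>

lemma seq_dist_metric:
  assumes "0 < \<theta>" "\<theta> < 1"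
  shows "Metric_space S (seq_dist \<theta>)"
proof
  fix x y z :: "nat \<Rightarrow> 'a"
  show "0 \<le> seq_dist \<theta> x y" using assms by (simp add: seq_dist_nonneg)
  show "seq_dist \<theta> x y = seq_dist \<theta> y x" by (simp add: seq_dist_def eq_commute)
  show "seq_dist \<theta> x y = 0 \<longleftrightarrow> x = y" using assms by (simp add: seq_dist_def)
  show "seq_dist \<theta> x z \<le> seq_dist \<theta> x y + seq_dist \<theta> y z"
  proof (cases "x = y \<or> y = z")
    case False
    define m n where "m = (LEAST i. x i \<noteq> y i)" and "n = (LEAST i. y i \<noteq> z i)"
    have "x j = z j" if "j < min m n" for j
      using not_less_Least[of j "\<lambda>i. x i \<noteq> y i"] not_less_Least[of j "\<lambda>i. y i \<noteq> z i"] that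
      by (simp add: m_def n_def)
    hence "seq_dist \<theta> x z \<le> \<theta> ^ min m n" by (rule seq_dist_le[OF assms])
    also have "\<dots> \<le> \<theta> ^ m + \<theta> ^ n" using assms by (simp add: min_def)
    finally show ?thesis using False by (simp add: seq_dist_def m_def n_def)
  qed (auto simp: seq_dist_def)
qed

context free_group
begin

abbreviation "\<Omega> \<equiv> infinite_words G A"

lemma cylinder_Nil [simp]: "cylinder G A [] = \<Omega>"
  by (simp add: cylinder_def)

lemma prefix_reduced:
  assumes "x \<in> \<Omega>"
  shows "map x [0..<n] \<in> R"
  using assms by (auto simp: reduced_words_def infinite_words_def)

lemma in_cylinder_iff: "x \<in> cylinder G A w \<longleftrightarrow> x \<in> \<Omega> \<and> map x [0..<length w] = w"
  unfolding cylinder_def list_eq_iff_nth_eq by simp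

lemma cylinder_subset: "cylinder G A w \<subseteq> \<Omega>"
  by (simp add: cylinder_def)

lemma cylinder_disjoint:
  "length v = length w \<Longrightarrow> v \<noteq> w \<Longrightarrow> cylinder G A v \<inter> cylinder G A w = {}"
  unfolding disjoint_iff in_cylinder_iff by metis

lemma cylinder_Int:
  assumes "length v \<le> length w"
  shows "cylinder G A v \<inter> cylinder G A w \<in> {{}, cylinder G A w}"
proof (cases "\<exists>x. x \<in> cylinder G A v \<inter> cylinder G A w")
  case True
  then obtain x where x: "x \<in> cylinder G A v" "x \<in> cylinder G A w" by blast
  have "w ! j = v ! j" if "j < length v" for j
  proof -
    have "x j = v ! j" "x j = w ! j" using x that assms by (simp_all add: cylinder_def)
    thus ?thesis by simp
  qed
  hence "cylinder G A w \<subseteq> cylinder G A v" using assms by (auto simp: cylinder_def)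
  thus ?thesis by (simp add: Int_absorb1)
qed auto

lemma Int_stable_cylinders: "Int_stable (insert {} (cylinder G A ` R))"
proof (rule Int_stableI)
  fix a b assume a: "a \<in> insert {} (cylinder G A ` R)" and b: "b \<in> insert {} (cylinder G A ` R)"
  show "a \<inter> b \<in> insert {} (cylinder G A ` R)"
  proof (cases "a = {} \<or> b = {}")
    case False
    then obtain v w where "v \<in> R" "w \<in> R" "a = cylinder G A v" "b = cylinder G A w" using a b by blast
    thus ?thesis using cylinder_Int[of v w] cylinder_Int[of w v]
      by (cases "length v \<le> length w") (auto simp: Int_commute)
  qed auto
qed

text \<open>
  An open set is the union of the cylinders it contains, and there are only countably many cylinders,
  because the alphabet is finite.
\<close>

lemma sets_borel_infinite_words:
  assumes \<theta>: "0 < \<theta>" "\<theta> < 1"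
  shows "sets (borel_infinite_words G A \<theta>) = sigma_sets \<Omega> (cylinder G A ` R)"
proof -
  interpret Metric_space \<Omega> "seq_dist \<theta>" by (rule seq_dist_metric[OF \<theta>])
  have "sets (borel_infinite_words G A \<theta>) = sigma_sets \<Omega> {U. openin mtopology U}"
    unfolding borel_infinite_words_def by (rule sets_measure_of) (auto simp: openin_mtopology)
  also have "\<dots> = sigma_sets \<Omega> (cylinder G A ` R)"
  proof (rule sigma_sets_eqI)
    fix U assume "U \<in> {U. openin mtopology U}"
    hence U: "U \<subseteq> \<Omega>" "\<And>x. x \<in> U \<Longrightarrow> \<exists>r>0. mball x r \<subseteq> U" by (auto simp: openin_mtopology)
    define B where "B = cylinder G A ` {w \<in> R. cylinder G A w \<subseteq> U}"
    have "x \<in> \<Union>B" if "x \<in> U" for x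
    proof -
      obtain r where r: "r > 0" "mball x r \<subseteq> U" using U(2) \<open>x \<in> U\<close> by blast
      obtain n where n: "\<theta> ^ n < r" using real_arch_pow_inv[OF r(1) \<theta>(2)] by blast
      let ?w = "map x [0..<n]"
      have x: "x \<in> \<Omega>" using U that by blast
      have "cylinder G A ?w \<subseteq> mball x r"
      proof
        fix y assume y: "y \<in> cylinder G A ?w"
        hence "seq_dist \<theta> x y \<le> \<theta> ^ n" by (intro seq_dist_le[OF \<theta>]) (auto simp: cylinder_def)
        thus "y \<in> mball x r" using y x n cylinder_subset by auto
      qed
      moreover have "x \<in> cylinder G A ?w" using x by (simp add: in_cylinder_iff)
      ultimately show ?thesis using prefix_reduced[OF x, of n] r(2) unfolding B_def by blast
    qed
    hence U_eq: "U = \<Union>B" unfolding B_def by blast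
    have "countable B"
    proof -
      have "R \<subseteq> lists L" using reduced_set by (auto simp: lists_eq_set)
      hence "countable R" using countable_lists[OF countable_finite[OF finite_letters]] by (rule countable_subset)
      hence "countable {w \<in> R. cylinder G A w \<subseteq> U}" by (rule countable_subset[rotated]) blast
      thus ?thesis unfolding B_def by (rule countable_image)
    qed
    thus "U \<in> sigma_sets \<Omega> (cylinder G A ` R)"
      unfolding U_eq by (rule sigma_sets_UNION) (auto simp: B_def intro: sigma_sets.Basic)
  next
    fix U assume "U \<in> cylinder G A ` R"
    then obtain w where w: "w \<in> R" "U = cylinder G A w" by blast
    have "mball x (\<theta> ^ length w) \<subseteq> U" if "x \<in> U" for x
      using that agree_if_seq_dist_less[OF \<theta>] by (fastforce simp: w(2) cylinder_def)
    hence "openin mtopology U"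
      using cylinder_subset[of w] \<theta>(1) w(2) by (auto simp: openin_mtopology intro!: exI[of _ "\<theta> ^ length w"])
    thus "U \<in> sigma_sets \<Omega> {U. openin mtopology U}" by (simp add: sigma_sets.Basic)
  qed
  finally show ?thesis .
qed

lemma space_borel_infinite_words: "space (borel_infinite_words G A \<theta>) = \<Omega>"
  unfolding borel_infinite_words_def by (rule space_measure_of_conv)

text \<open>
  The cylinders together with the empty set form a generator closed under intersection.
\<close>

lemma prob_measure_eqI_cylinder:
  assumes \<theta>: "0 < \<theta>" "\<theta> < 1" and "prob_space M" "prob_space N"
    and sets: "sets M = sets (borel_infinite_words G A \<theta>)" "sets N = sets (borel_infinite_words G A \<theta>)"
    and eq: "\<And>w. w \<in> R \<Longrightarrow> w \<noteq> [] \<Longrightarrow> measure M (cylinder G A w) = measure N (cylinder G A w)"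
  shows "M = N"
proof -
  interpret M: prob_space M by fact
  interpret N: prob_space N by fact
  have space: "space M = \<Omega>" "space N = \<Omega>"
    using sets[THEN sets_eq_imp_space_eq] by (simp_all add: space_borel_infinite_words)
  let ?E = "insert {} (cylinder G A ` R)"
  have gen: "sets (borel_infinite_words G A \<theta>) = sigma_sets \<Omega> ?E"
  proof -
    have "sigma_sets \<Omega> (cylinder G A ` R) = sigma_sets \<Omega> ?E"
      by (rule sigma_sets_eqI) (auto intro: sigma_sets.Basic sigma_sets.Empty)
    thus ?thesis by (simp add: sets_borel_infinite_words[OF \<theta>])
  qed
  show ?thesis
  proof (rule measure_eqI_generator_eq[OF Int_stable_cylinders, of \<Omega> M N "\<lambda>_. \<Omega>"])
    show "?E \<subseteq> Pow \<Omega>" using cylinder_subset by auto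
    fix X assume "X \<in> ?E"
    then consider "X = {}" | "X = \<Omega>" | w where "w \<in> R" "w \<noteq> []" "X = cylinder G A w" by force
    thus "emeasure M X = emeasure N X"
    proof cases
      case 2
      thus ?thesis using M.emeasure_space_1 N.emeasure_space_1 space by simp
    next
      case 3
      thus ?thesis using eq by (simp add: M.emeasure_eq_measure N.emeasure_eq_measure)
    qed simp
  next
    show "range (\<lambda>_. \<Omega>) \<subseteq> ?E" using imageI[OF Nil_reduced, of "cylinder G A"] by auto
  qed (use gen sets in auto)
qed

lemma measurable_infinite_words:
  assumes \<theta>: "0 < \<theta>" "\<theta> < 1" and N: "sets N = sets (borel_infinite_words G A \<theta>)"
    and "\<And>u. u \<in> space M \<Longrightarrow> h u \<in> \<Omega>"
    and "\<And>w. w \<in> R \<Longrightarrow> h -` cylinder G A w \<inter> space M \<in> sets M"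
  shows "h \<in> measurable M N"
  by (rule measurable_sigma_sets[of N \<Omega> "cylinder G A ` R"])
    (use assms sets_borel_infinite_words[OF \<theta>] in \<open>auto dest: subsetD[OF cylinder_subset]\<close>)

lemma cylinder_in_sets:
  "\<lbrakk>0 < \<theta>; \<theta> < 1; sets M = sets (borel_infinite_words G A \<theta>); w \<in> R\<rbrakk> \<Longrightarrow> cylinder G A w \<in> sets M"
  by (simp add: sets_borel_infinite_words sigma_sets.Basic)

definition cylinder_mass :: "nat \<Rightarrow> real" where
  "cylinder_mass n = 1 / (2 * real (card A) * q ^ (n - 1))"

lemma card_successors: "a \<in> L \<Longrightarrow> real (card (L - {inv a})) = 2 * real (card A) - 1"
  using card_basis by (simp add: card_Diff_singleton card_letters of_nat_diff)

lemma shift_infinite_word: "x \<in> \<Omega> \<Longrightarrow> shift_map x \<in> \<Omega>"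
  by (simp add: infinite_words_def shift_map_def)

lemma in_cylinder_Cons_iff:
  "x \<in> cylinder G A (a # w) \<longleftrightarrow> x \<in> \<Omega> \<and> x 0 = a \<and> shift_map x \<in> cylinder G A w"
  using shift_infinite_word[of x] by (auto simp: cylinder_def shift_map_def All_less_Suc2)

lemma shift_vimage_cylinder:
  assumes "w \<in> R" "w \<noteq> []"
  shows "shift_map -` cylinder G A w \<inter> \<Omega> = (\<Union>a\<in>L - {inv (hd w)}. cylinder G A (a # w))"
proof -
  have hdw: "hd w = w ! 0" "hd w \<in> L"
    using hd_conv_nth[OF assms(2)] reduced_hd[OF assms] by blast+
  have "x 0 \<noteq> inv (hd w)" if "x \<in> \<Omega>" "shift_map x \<in> cylinder G A w" for x
  proof -
    have "x (Suc 0) = hd w" using that assms(2) hdw by (simp add: cylinder_def shift_map_def)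
    moreover have "x (Suc 0) \<noteq> inv (x 0)" using that(1) by (simp add: infinite_words_def)
    ultimately show ?thesis using hdw(2) by auto
  qed
  moreover have "x 0 \<in> L" if "x \<in> \<Omega>" for x using that by (simp add: infinite_words_def)
  ultimately show ?thesis by (auto simp: in_cylinder_Cons_iff)
qed

text \<open>
  Shift invariance follows from the masses: the preimage of a cylinder of length \<open>n\<close> consists of $q$
  cylinders of length $n + 1$, each of them with a $q$-th of its mass.
\<close>

lemma is_max_entropy_measureI:
  assumes \<theta>: "0 < \<theta>" "\<theta> < 1" and "prob_space M"
    and sets: "sets M = sets (borel_infinite_words G A \<theta>)"
    and mass: "\<And>w. w \<in> R \<Longrightarrow> w \<noteq> [] \<Longrightarrow> measure M (cylinder G A w) = cylinder_mass (length w)"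
  shows "is_max_entropy_measure G A \<theta> M"
proof -
  interpret M: prob_space M by fact
  have space: "space M = \<Omega>"
    using sets_eq_imp_space_eq[OF sets] by (simp add: space_borel_infinite_words)
  have cyl: "cylinder G A w \<in> sets M" if "w \<in> R" for w
    using cylinder_in_sets[OF \<theta> sets that] .
  have Cons: "a # w \<in> R" if "w \<in> R" "w \<noteq> []" "a \<in> L - {inv (hd w)}" for a w
    using that reduced_hd[of w] by (auto simp: reduced_Cons_iff)
  have shift: "shift_map \<in> measurable M M"
  proof (rule measurable_infinite_words[OF \<theta> sets])
    show "shift_map x \<in> \<Omega>" if "x \<in> space M" for x
      using that shift_infinite_word by (simp add: space)
    fix w assume w: "w \<in> R"
    show "shift_map -` cylinder G A w \<inter> space M \<in> sets M"
    proof (cases "w = []")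
      case True
      have "shift_map -` cylinder G A w \<inter> space M = space M"
        using shift_infinite_word by (auto simp: True space)
      thus ?thesis by simp
    next
      case False
      thus ?thesis unfolding space shift_vimage_cylinder[OF w False]
        using w Cons by (intro sets.finite_UN) (auto intro!: cyl)
    qed
  qed
  have "distr M M shift_map = M"
  proof (rule prob_measure_eqI_cylinder[OF \<theta>])
    show "prob_space (distr M M shift_map)" by (rule M.prob_space_distr[OF shift])
    fix w assume w: "w \<in> R" "w \<noteq> []"
    have "measure (distr M M shift_map) (cylinder G A w)
        = measure M (\<Union>a\<in>L - {inv (hd w)}. cylinder G A (a # w))"
      using shift_vimage_cylinder[OF w] by (simp add: measure_distr[OF shift cyl[OF w(1)]] space)
    also have "\<dots> = (\<Sum>a\<in>L - {inv (hd w)}. measure M (cylinder G A (a # w)))"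
      using Cons[OF w] by (intro M.finite_measure_finite_Union)
        (auto simp: disjoint_family_on_def intro!: cyl cylinder_disjoint)
    also have "\<dots> = (\<Sum>a\<in>L - {inv (hd w)}. cylinder_mass (Suc (length w)))"
      by (intro sum.cong refl) (simp add: mass Cons[OF w])
    also have "\<dots> = (2 * real (card A) - 1) * cylinder_mass (Suc (length w))"
      using card_successors[OF reduced_hd[OF w]] by simp
    also have "\<dots> = cylinder_mass (length w)"
      using w(2) card_basis by (cases w) (auto simp: cylinder_mass_def field_simps)
    finally show "measure (distr M M shift_map) (cylinder G A w) = measure M (cylinder G A w)"
      using mass w by simp
  qed (use assms in auto)
  thus ?thesis
    using assms shift space by (simp add: is_max_entropy_measure_def cylinder_mass_def)
qed

text \<open>
  The uniform Markov chain on letters, written as a deterministic function of independent choices: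
  for each time \<open>n\<close> and each \<open>a\<close>, a uniformly distributed letter that may follow \<open>a\<close> is drawn in
  advance, and the walk looks up the choices that it needs. The start is a step from the unit, which
  forbids nothing because its inverse is not a letter. A cylinder then becomes a condition on
  finitely many distinct coordinates, so its mass is a product.
\<close>

definition choice_space :: "(nat \<times> 'g \<Rightarrow> 'g) measure" where
  "choice_space = PiM UNIV (\<lambda>(n, a). uniform_count_measure (L - {inv a}))"

primrec walk :: "(nat \<times> 'g \<Rightarrow> 'g) \<Rightarrow> nat \<Rightarrow> 'g" where
  "walk u 0 = u (0, \<one>)"
| "walk u (Suc n) = u (Suc n, walk u n)"

definition preceding :: "'g list \<Rightarrow> nat \<Rightarrow> 'g" where
  "preceding w i = (if i = 0 then \<one> else w ! (i - 1))"

lemma walk_prefix_iff: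
  "(\<forall>i<n. walk u i = w ! i) \<longleftrightarrow> (\<forall>i<n. u (i, preceding w i) = w ! i)"
proof (induction n)
  case (Suc n)
  have "walk u n = u (n, preceding w n)" if "\<forall>i<n. walk u i = w ! i"
    using that by (cases n) (auto simp: preceding_def)
  thus ?case using Suc by (auto simp: less_Suc_eq)
qed simp

lemma successors_nonempty: "L - {inv a} \<noteq> {}"
proof
  assume "L - {inv a} = {}"
  hence "card L \<le> card {inv a}" by (intro card_mono) auto
  thus False using card_letters card_basis by simp
qed

lemma prob_space_choice: "prob_space (uniform_count_measure (L - {inv a}))"
  by (rule prob_space_uniform_count_measure) (use successors_nonempty in auto)

lemma product_prob_space_choice:
  "product_prob_space (\<lambda>(n, a). uniform_count_measure (L - {inv a}))"
  by (rule product_prob_spaceI) (auto intro: prob_space_choice)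

lemma space_choice_space: "u \<in> space choice_space \<Longrightarrow> u (n, a) \<in> L - {inv a}"
  by (auto simp: choice_space_def space_PiM PiE_iff space_uniform_count_measure split: prod.splits)

lemma walk_infinite_word: "u \<in> space choice_space \<Longrightarrow> walk u \<in> \<Omega>"
proof -
  assume u: "u \<in> space choice_space"
  have "walk u n \<in> L" for n using space_choice_space[OF u] by (cases n) auto
  thus ?thesis using space_choice_space[OF u] by (auto simp: infinite_words_def)
qed

lemma walk_cylinder:
  assumes w: "w \<in> R"
  shows "walk -` cylinder G A w \<inter> space choice_space \<in> sets choice_space" (is ?meas)
    and "w \<noteq> [] \<Longrightarrow> measure choice_space (walk -` cylinder G A w \<inter> space choice_space) = cylinder_mass (length w)"
proof -
  interpret product_prob_space "\<lambda>(n, a). uniform_count_measure (L - {inv a})" "UNIV :: (nat \<times> 'g) set"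
    by (rule product_prob_space_choice)
  define J where "J = (\<lambda>i. (i, preceding w i)) ` {..<length w}"
  define X where "X = (\<lambda>(i, a :: 'g). {w ! i})"
  have wi: "w ! i \<in> L - {inv (preceding w i)}" if "i < length w" for i
  proof (cases i)
    case 0
    thus ?thesis using that reduced_set[OF w] one_not_letter by (auto simp: preceding_def)
  next
    case (Suc j)
    thus ?thesis using that w reduced_set[OF w] by (auto simp: preceding_def reduced_words_def)
  qed
  have eq: "walk -` cylinder G A w \<inter> space choice_space = {u \<in> space choice_space. \<forall>j\<in>J. u j \<in> X j}"
    using walk_infinite_word walk_prefix_iff[of "length w" _ w] by (auto simp: cylinder_def J_def X_def)
  have X: "X j \<in> sets (case j of (n, a) \<Rightarrow> uniform_count_measure (L - {inv a}))" if "j \<in> J" for j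
    using that wi by (auto simp: J_def X_def sets_uniform_count_measure)
  show ?meas unfolding eq unfolding choice_space_def 
    by (intro sets.sets_Collect_finite_All sets_Collect_single') (use X in \<open>auto simp: J_def\<close>)
  have "emeasure choice_space (walk -` cylinder G A w \<inter> space choice_space)
      = (\<Prod>j\<in>J. emeasure (case j of (n, a) \<Rightarrow> uniform_count_measure (L - {inv a})) (X j))"
    unfolding eq unfolding choice_space_def by (rule emeasure_PiM_Collect) (use X in \<open>auto simp: J_def\<close>)
  also have "\<dots> = (\<Prod>i<length w. ennreal (1 / real (card (L - {inv (preceding w i)}))))"
    unfolding J_def using wi
    by (subst prod.reindex) (auto simp: inj_on_def X_def emeasure_uniform_count_measure intro!: prod.cong)
  also have "\<dots> = ennreal (\<Prod>i<length w. 1 / real (card (L - {inv (preceding w i)})))"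
    by (rule prod_ennreal) simp
  finally have em: "emeasure choice_space (walk -` cylinder G A w \<inter> space choice_space)
      = ennreal (\<Prod>i<length w. 1 / real (card (L - {inv (preceding w i)})))" .
  assume "w \<noteq> []"
  then obtain n where n: "length w = Suc n" by (cases w) auto
  have "(\<Prod>i<length w. 1 / real (card (L - {inv (preceding w i)}))) = cylinder_mass (length w)"
  proof -
    have "card (L - {inv (preceding w 0)}) = 2 * card A"
      using one_not_letter by (simp add: preceding_def card_letters)
    moreover have "real (card (L - {inv (preceding w (Suc i))})) = 2 * real (card A) - 1" if "i < n" for i
    proof -
      have "w ! i \<in> L" using that n reduced_set[OF w] by (auto intro: subsetD)
      moreover have "preceding w (Suc i) = w ! i" by (simp add: preceding_def)
      ultimately show ?thesis by (simp only: card_successors)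
    qed
    ultimately show ?thesis
      unfolding n prod.lessThan_Suc_shift by (simp add: cylinder_mass_def power_one_over)
  qed
  thus "measure choice_space (walk -` cylinder G A w \<inter> space choice_space) = cylinder_mass (length w)"
    using em card_basis by (simp add: measure_def cylinder_mass_def)
qed

lemma exists_max_entropy_measure:
  assumes \<theta>: "0 < \<theta>" "\<theta> < 1"
  shows "is_max_entropy_measure G A \<theta> (distr choice_space (borel_infinite_words G A \<theta>) walk)"
proof -
  let ?B = "borel_infinite_words G A \<theta>"
  interpret P: prob_space choice_space
    unfolding choice_space_def by (rule prob_space_PiM) (auto intro: prob_space_choice)
  have walk: "walk \<in> measurable choice_space ?B"
    by (rule measurable_infinite_words[OF \<theta> refl]) (use walk_infinite_word walk_cylinder in auto)
  show ?thesis
  proof (rule is_max_entropy_measureI[OF \<theta>])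
    show "prob_space (distr choice_space ?B walk)" by (rule P.prob_space_distr[OF walk])
    fix w assume w: "w \<in> R" "w \<noteq> []"
    show "measure (distr choice_space ?B walk) (cylinder G A w) = cylinder_mass (length w)"
      using walk_cylinder(2)[OF w] by (simp add: measure_distr[OF walk cylinder_in_sets[OF \<theta> refl w(1)]])
  qed simp
qed

lemma is_max_entropy_max_entropy_measure:
  assumes \<theta>: "0 < \<theta>" "\<theta> < 1"
  shows "is_max_entropy_measure G A \<theta> (max_entropy_measure G A \<theta>)"
  unfolding max_entropy_measure_def
proof (rule theI[of "is_max_entropy_measure G A \<theta>", OF exists_max_entropy_measure[OF \<theta>]])
  fix M assume "is_max_entropy_measure G A \<theta> M"
  thus "M = distr choice_space (borel_infinite_words G A \<theta>) walk"
    using exists_max_entropy_measure[OF \<theta>]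
    by (intro prob_measure_eqI_cylinder[OF \<theta>]) (auto simp: is_max_entropy_measure_def)
qed

end

context hoelder_potential
begin

text \<open>
  The function \<open>g n\<close> below evaluates \<open>f\<close> at the first \<open>n\<close> letters, padded with units. It is a step
  function on cylinders whose integral is an average over finite words, and it approximates \<open>f\<close>
  uniformly; this also makes \<open>f\<close> measurable.
\<close>

lemma level_mean_tendsto_integral:
  assumes \<theta>: "0 < \<theta>" "\<theta> < 1"
  shows "level_mean \<longlonglongrightarrow> (\<integral>x. f x \<partial>max_entropy_measure G A \<theta>)"
proof -
  define M where "M = max_entropy_measure G A \<theta>"
  have M: "prob_space M" "space M = \<Omega>" "sets M = sets (borel_infinite_words G A \<theta>)"
    "\<And>w. w \<in> R \<Longrightarrow> w \<noteq> [] \<Longrightarrow> measure M (cylinder G A w) = cylinder_mass (length w)"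
    using is_max_entropy_max_entropy_measure[OF \<theta>] unfolding M_def[symmetric]
    by (auto simp: is_max_entropy_measure_def cylinder_mass_def)
  interpret M: prob_space M by (rule M(1))
  define g where "g n x = f (pad (map x [0..<n]))" for n x
  have ext: "x \<in> extended_words G A" if "x \<in> \<Omega>" for x using that by (simp add: extended_words_def)
  have close: "\<bar>f x - g n x\<bar> \<le> K * \<rho> ^ n" if "x \<in> \<Omega>" for x n
    unfolding g_def using ext[OF that] prefix_reduced[OF that] pad_extended
    by (intro hoelder) (auto simp: pad_def)
  have K\<rho>: "(\<lambda>n. K * \<rho> ^ n) \<longlonglongrightarrow> 0"
    using \<rho> by (intro tendsto_mult_right_zero LIMSEQ_realpow_zero) auto
  have step: "g n x = (\<Sum>w\<in>{w \<in> R. length w = n}. f (pad w) * indicator (cylinder G A w) x)"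
    if x: "x \<in> \<Omega>" for n x
  proof -
    have "(\<Sum>w\<in>{w \<in> R. length w = n}. f (pad w) * indicator (cylinder G A w) x)
        = (\<Sum>w\<in>{map x [0..<n]}. f (pad w) * indicator (cylinder G A w) x)"
      using prefix_reduced[OF x] finite_words_of_length[of n "\<lambda>_. True"]
      by (intro sum.mono_neutral_right) (auto simp: in_cylinder_iff indicator_def)
    thus ?thesis using x by (simp add: g_def in_cylinder_iff)
  qed
  have cyl: "cylinder G A w \<in> sets M" if "w \<in> R" for w using cylinder_in_sets[OF \<theta> M(3) that] .
  have g_meas: "g n \<in> borel_measurable M" for n
  proof -
    have "(\<lambda>x. \<Sum>w\<in>{w \<in> R. length w = n}. f (pad w) * indicator (cylinder G A w) x) \<in> borel_measurable M"
      using cyl by (intro borel_measurable_sum borel_measurable_times borel_measurable_indicator) auto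
    thus ?thesis using step M(2) by (subst measurable_cong) auto
  qed
  have f_meas: "f \<in> borel_measurable M"
  proof (rule borel_measurable_LIMSEQ_real[OF _ g_meas])
    fix x assume "x \<in> space M"
    hence "\<And>n. \<bar>g n x - f x\<bar> \<le> K * \<rho> ^ n" using close M(2) by (simp add: abs_minus_commute)
    hence "(\<lambda>n. g n x - f x) \<longlonglongrightarrow> 0" by (intro Lim_null_comparison[OF _ K\<rho>]) auto
    thus "(\<lambda>n. g n x) \<longlonglongrightarrow> f x" by (rule LIM_zero_cancel)
  qed
  have f_int: "integrable M f"
    by (rule M.integrable_const_bound[of _ potential_bound]) (use f_meas potential_bounded ext M(2) in auto)
  have g_int: "integrable M (g n)" for n
    by (rule M.integrable_const_bound[of _ potential_bound])
      (use g_meas potential_bounded pad_extended prefix_reduced M(2) in \<open>auto simp: g_def\<close>)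
  have g_integral: "(\<integral>x. g (Suc n) x \<partial>M) = level_mean n" for n
  proof -
    have "(\<integral>x. g (Suc n) x \<partial>M)
        = (\<integral>x. (\<Sum>w\<in>{w \<in> R. length w = Suc n}. f (pad w) * indicator (cylinder G A w) x) \<partial>M)"
      using step M(2) by (intro Bochner_Integration.integral_cong) auto
    also have "\<dots> = (\<Sum>w\<in>{w \<in> R. length w = Suc n}. f (pad w) * measure M (cylinder G A w))"
    proof (subst Bochner_Integration.integral_sum)
      fix w assume "w \<in> {w \<in> R. length w = Suc n}"
      hence "cylinder G A w \<in> sets M" using cyl by simp
      thus "integrable M (\<lambda>x. f (pad w) * indicator (cylinder G A w) x)"
        by (intro integrable_mult_right integrable_real_indicator) (simp_all add: M.emeasure_finite less_top[symmetric])
    qed (use cylinder_subset M(2) in \<open>simp add: Int_absorb2\<close>)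
    also have "\<dots> = (\<Sum>w\<in>{w \<in> R. length w = Suc n}. f (pad w) * cylinder_mass (Suc n))"
      by (intro sum.cong refl) (auto simp: M(4) simp flip: length_greater_0_conv)
    also have "\<dots> = level_mean n"
      by (simp add: level_mean_def cylinder_mass_def sum_divide_distrib)
    finally show ?thesis .
  qed
  have "\<bar>level_mean n - (\<integral>x. f x \<partial>M)\<bar> \<le> K * \<rho> ^ Suc n" for n
  proof -
    have "level_mean n - (\<integral>x. f x \<partial>M) = (\<integral>x. g (Suc n) x - f x \<partial>M)"
      using f_int g_int by (simp add: g_integral)
    also have "\<bar>\<dots>\<bar> \<le> (\<integral>x. \<bar>g (Suc n) x - f x\<bar> \<partial>M)" by (rule integral_abs_bound)
    also have "\<dots> \<le> (\<integral>x. K * \<rho> ^ Suc n \<partial>M)"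
      using close M(2) f_int g_int by (intro integral_mono) (auto simp: abs_minus_commute simp del: power_Suc)
    also have "\<dots> = K * \<rho> ^ Suc n" by (simp add: M.prob_space)
    finally show ?thesis .
  qed
  hence "(\<lambda>n. level_mean n - (\<integral>x. f x \<partial>M)) \<longlonglongrightarrow> 0"
    by (intro Lim_null_comparison[OF _ LIMSEQ_Suc[OF K\<rho>]]) auto
  thus ?thesis unfolding M_def by (rule LIM_zero_cancel)
qed

end

theorem theorem2p2:
  fixes G :: "('g, 'm) monoid_scheme"
    and A :: "'g set"
    and C :: "'g set"
    and k :: nat
    and \<theta> :: real
    and F :: "'g \<Rightarrow> real"
    and f :: "(nat \<Rightarrow> 'g) \<Rightarrow> real"
  assumes "group G"
    and "finite A" and "card A \<ge> 2" and "free_generating_set G A"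
    and "\<exists>g \<in> carrier G. C = conjugacy_class G g" and "C \<noteq> {\<one>\<^bsub>G\<^esub>}"
    and "k = (LEAST n. \<exists>x\<in>C. word_length G A x = n)"
    and "0 < \<theta>" and "\<theta> < 1"
    and "hoelder_on (extended_words G A) (seq_dist \<theta>) f"
    and "\<forall>n. \<forall>x \<in> level G A (carrier G) n. F x = birkhoff_sum f n (word_seq G A x)"
    and "\<forall>x \<in> carrier G. F x = F (inv\<^bsub>G\<^esub> x)"
  shows "\<exists>Fbar :: real.
    ((\<lambda>m. 1 / real (card (level G A C (k + 2 * m))) *
        (\<Sum>x \<in> level G A C (k + 2 * m). F x / real (k + 2 * m))) \<longlonglongrightarrow> Fbar) \<and>
    Fbar = (\<integral>x. f x \<partial>(max_entropy_measure G A \<theta>))"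
proof -
  obtain K \<rho> where K\<rho>: "0 \<le> K" "0 < \<rho>" "\<rho> < 1"
    "\<And>x y n. x \<in> extended_words G A \<Longrightarrow> y \<in> extended_words G A \<Longrightarrow> (\<And>j. j < n \<Longrightarrow> x j = y j)
      \<Longrightarrow> \<bar>f x - f y\<bar> \<le> K * \<rho> ^ n"
    using hoelder_on_seq_dist_imp[OF assms(10,8,9)] by blast
  interpret free_group G A
    using assms(1-4) by (simp add: free_group_def free_group_axioms_def)
  interpret hoelder_potential G A f K \<rho>
    by unfold_locales (use K\<rho> in auto)
  obtain g where g: "g \<in> carrier G" "C = conjugacy_class G g" using assms(5) by blast
  have F: "F (word_eval G w) = word_sum w" if "w \<in> reduced_words G A" for w
    using assms(11) that reduced_set[OF that]
    by (simp add: level_def word_sum_def word_seq_word_eval)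
  show ?thesis
    using class_average_limit[OF g(1) _ _ F _ level_mean_tendsto_integral[OF assms(8,9)]] assms(6,7,12)
    unfolding g(2) by blast
qed

end
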